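(* Let $n\ge1$ and $d\ge3$ be integers. Real orthogonal $n \times \dots \times n$ tensors of order $d$ exist if and only if $n \in\{ 1,2,4,8\}$. Consequently, for $d\ge3$, \[ \operatorname{App}_d(\mathbb{R};n,\dots,n) = \frac{1}{\sqrt{n^{d-1}}} \] if and only if $n \in\{ 1,2,4,8\}$. Otherwise, the value of $\operatorname{App}_d(\mathbb{R};n,\dots,n)$ is larger than $1/\sqrt{n^{d-1}}$.
   Context: Orthogonal tensors: a vector is orthogonal if its Euclidean norm is one; for $n_1\le\dots\le n_d$, $d\ge2$, a real tensor $\mathbf{X}\in\mathbb{R}^{n_1\times\dots\times n_d}$ is orthogonal if for every unit vector $u\in\mathbb{R}^{n_1}$ the order-$(d-1)$ tensor $\mathbf{X}\times_1u$ with entries $\sum_{i}u(i)\mathbf{X}(i,i_2,\dots,i_d)$ is orthogonal. The Frobenius norm $\|\mathbf{X}\|_F$ is the Euclidean norm of the array of entries, with inner product $\langle\mathbf{X},\mathbf{Y}\rangle_F=\sum_{i_1,\dots,i_d}\mathbf{X}(i_1,\dots,i_d)\mathbf{Y}(i_1,\dots,i_d)$; the spectral norm is $\|\mathbf{X}\|_2=\max\{|\langle\mathbf{X},u^1\otimes\dots\otimes u^d\rangle_F|: \|u^1\|=\dots=\|u^d\|=1\}$, where $u^1\otimes\dots\otimes u^d$ has entries $u^1(i_1)\cdots u^d(i_d)$; and $\operatorname{App}_d(\mathbb{R};n,\dots,n)=\min_{\mathbf{X}\ne0}\|\mathbf{X}\|_2/\|\mathbf{X}\|_F$ over $\mathbf{X}\in\mathbb{R}^{n\times\dots\times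 n}$ (order $d$). *)

theory Defs
  imports "HOL-Analysis.Analysis"
begin

text \<open>
  A tensor of format \<open>n\<^sub>1 \<times> \<dots> \<times> n\<^sub>d\<close> is a function on 0-based multi-indices
  \<open>[i\<^sub>1, \<dots>, i\<^sub>d]\<close>, and its format is the list \<open>[n\<^sub>1, \<dots>, n\<^sub>d]\<close>, so that the order is the
  length of the format. A vector of length \<open>n\<close> is a function of which only the values on
  \<open>{..<n}\<close> matter.
\<close>

definition multi_indices :: "nat list \<Rightarrow> nat list set" where
  "multi_indices ns = {is. list_all2 (<) is ns}"

text \<open>Entries outside the format are required to vanish, so that every array of entries has
  exactly one representative and \<open>X \<noteq> (\<lambda>_. 0)\<close> means that the tensor is nonzero.\<close>

definition tensors :: "nat list \<Rightarrow> (nat list \<Rightarrow> real) set" where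
  "tensors ns = {X. \<forall>is. is \<notin> multi_indices ns \<longrightarrow> X is = 0}"

definition unit_vector :: "nat \<Rightarrow> (nat \<Rightarrow> real) \<Rightarrow> bool" where
  "unit_vector n u \<longleftrightarrow> L2_set u {..<n} = 1"

definition frobenius_inner ::
    "nat list \<Rightarrow> (nat list \<Rightarrow> real) \<Rightarrow> (nat list \<Rightarrow> real) \<Rightarrow> real" where
  "frobenius_inner ns X Y = (\<Sum>is\<in>multi_indices ns. X is * Y is)"

definition frobenius_norm :: "nat list \<Rightarrow> (nat list \<Rightarrow> real) \<Rightarrow> real" where
  "frobenius_norm ns X = L2_set X (multi_indices ns)"

text \<open>The contraction \<open>X \<times>\<^sub>1 u\<close>, where \<open>n\<close> is the first dimension of \<open>X\<close>.\<close>

definition contract_first ::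
    "nat \<Rightarrow> (nat list \<Rightarrow> real) \<Rightarrow> (nat \<Rightarrow> real) \<Rightarrow> nat list \<Rightarrow> real" where
  "contract_first n X u = (\<lambda>is. \<Sum>i<n. u i * X (i # is))"

text \<open>The recursion is the usual notion only for formats with \<open>n\<^sub>1 \<le> \<dots> \<le> n\<^sub>d\<close> and \<open>d \<ge> 1\<close>;
  it ends at order one, where the Euclidean norm has to be one. The value for the empty format
  is a convention without significance.\<close>

fun orthogonal_tensor :: "nat list \<Rightarrow> (nat list \<Rightarrow> real) \<Rightarrow> bool" where
  "orthogonal_tensor [] X \<longleftrightarrow> frobenius_norm [] X = 1"
| "orthogonal_tensor [n] X \<longleftrightarrow> frobenius_norm [n] X = 1"
| "orthogonal_tensor (n # m # ns) X \<longleftrightarrow>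
     (\<forall>u. unit_vector n u \<longrightarrow> orthogonal_tensor (m # ns) (contract_first n X u))"

text \<open>The tensor \<open>u\<^sup>1 \<otimes> \<dots> \<otimes> u\<^sup>d\<close>; the factors are numbered from 0.\<close>

definition elementary_tensor :: "nat list \<Rightarrow> (nat \<Rightarrow> nat \<Rightarrow> real) \<Rightarrow> nat list \<Rightarrow> real" where
  "elementary_tensor ns u =
     (\<lambda>is. if is \<in> multi_indices ns then \<Prod>k<length ns. u k (is ! k) else 0)"

text \<open>Maximum and minimum below are attained by compactness when all dimensions are positive;
  otherwise the two quantities are unspecified.\<close>

definition spectral_norm :: "nat list \<Rightarrow> (nat list \<Rightarrow> real) \<Rightarrow> real" where
  "spectral_norm ns X =
     (GREATEST r. \<exists>u. (\<forall>k<length ns. unit_vector (ns ! k) (u k)) \<and>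
                      r = \<bar>frobenius_inner ns X (elementary_tensor ns u)\<bar>)"

definition App :: "nat list \<Rightarrow> real" where
  "App ns = (LEAST r. \<exists>X\<in>tensors ns. X \<noteq> (\<lambda>_. 0) \<and> r = spectral_norm ns X / frobenius_norm ns X)"

end

theory Submission
  imports Defs "HOL-Library.Poly_Mapping"
begin

text \<open>
  A tensor of order three is orthogonal exactly when it is the array of structure constants of a
  bilinear product on Euclidean space with \<open>norm (x * y) = norm x * norm y\<close>. Hurwitz's theorem
  (\<open>hurwitz\<close>) says that such products exist only in dimensions 1, 2, 4 and 8. Contracting with
  unit vectors lowers the order, so orthogonal tensors of any order \<open>d \<ge> 3\<close> need one of these
  dimensions (\<open>orthogonal_tensor_dimension\<close>). In these dimensions the real numbers, complex numbers,
  quaternions and octonions provide the case of order three, and substituting the product of two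
  vectors for the first argument of an orthogonal tensor raises the order by one
  (\<open>orthogonal_tensor_exists\<close>).

  Hurwitz's theorem itself is proved by Cayley-Dickson doubling. Once the product has a unit, a
  vector \<open>j\<close> orthogonal to a subalgebra \<open>A\<close> generates a subalgebra \<open>A + A j\<close> of twice the dimension
  whose multiplication is determined by that of \<open>A\<close>, and the existence of \<open>j\<close> forces \<open>A\<close> to be
  associative. Starting from the line of the unit, associativity is lost after three doublings, so
  there is no fourth one.

  The statement on \<open>App\<close> rests on the inequality \<open>frobenius_le_of_form_bound\<close>, by which the ratio of
  spectral and Frobenius norm is at least \<open>1 / sqrt (n ^ (d - 1))\<close>: slice the tensor at its first
  index and argue by induction on the order. Equality propagates to the contractions with all unit vectors,
  because a quadratic form bounded on the sphere and of extremal trace is constant there, and it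
  therefore characterises the multiples of orthogonal tensors (\<open>orthogonal_of_form_bound\<close>). Since the
  minimum in \<open>App\<close> is attained by compactness, it equals the bound if and only if an orthogonal
  tensor exists (\<open>App_bound\<close>).
\<close>

section \<open>Orthonormal bases\<close>

definition orthonormal_basis :: "'a::real_inner set \<Rightarrow> 'a set \<Rightarrow> bool" where
  "orthonormal_basis B A \<longleftrightarrow>
     finite B \<and> pairwise orthogonal B \<and> (\<forall>b\<in>B. norm b = 1) \<and> span B = A"

lemma orthonormal_basis_independent: "orthonormal_basis B A \<Longrightarrow> independent B"
  unfolding orthonormal_basis_def by (metis norm_zero pairwise_orthogonal_independent zero_neq_one)

text \<open>
  The ambient space may be infinite-dimensional, so the dimension of a subspace is measured by
  the size of an orthonormal basis; this makes it well defined.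
\<close>

lemma orthonormal_basis_card_unique:
  assumes "orthonormal_basis B A" "orthonormal_basis C A"
  shows "card B = card C"
proof (rule antisym)
  have "finite B" "finite C" "B \<subseteq> span C" "C \<subseteq> span B"
    using assms span_superset[of B] span_superset[of C] by (simp_all add: orthonormal_basis_def)
  then show "card B \<le> card C" "card C \<le> card B"
    using independent_span_bound assms[THEN orthonormal_basis_independent] by blast+
qed

lemma orthonormal_basis_inner:
  assumes "orthonormal_basis B A" "b \<in> B" "c \<in> B"
  shows "b \<bullet> c = of_bool (b = c)"
  using assms by (auto simp: orthonormal_basis_def pairwise_def orthogonal_def norm_eq_1)

lemma orthonormal_residual:
  fixes B :: "'a::real_inner set"
  assumes "orthonormal_basis B A" "a \<in> A"
  shows "a \<bullet> (x - (\<Sum>b\<in>B. (x \<bullet> b) *\<^sub>R b)) = 0"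
proof -
  have fin: "finite B" and "a \<in> span B"
    using assms by (auto simp: orthonormal_basis_def)
  have "orthogonal (x - (\<Sum>b\<in>B. (x \<bullet> b) *\<^sub>R b)) a"
  proof (rule orthogonal_to_span[OF \<open>a \<in> span B\<close>])
    fix c assume c: "c \<in> B"
    have "c \<bullet> (\<Sum>b\<in>B. (x \<bullet> b) *\<^sub>R b) = (\<Sum>b\<in>B. if b = c then x \<bullet> c else 0)"
      unfolding inner_sum_right
      by (rule sum.cong) (auto simp: orthonormal_basis_inner[OF assms(1) c])
    also have "\<dots> = x \<bullet> c" using fin c by simp
    finally show "orthogonal (x - (\<Sum>b\<in>B. (x \<bullet> b) *\<^sub>R b)) c"
      by (simp add: orthogonal_def inner_diff_left inner_diff_right inner_commute)
  qed
  then show ?thesis by (simp add: orthogonal_def inner_commute)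
qed

lemma orthonormal_expansion:
  fixes B :: "'a::real_inner set"
  assumes "orthonormal_basis B A" "x \<in> A"
  shows "(\<Sum>b\<in>B. (x \<bullet> b) *\<^sub>R b) = x"
proof -
  have sp: "span B = A" using assms by (simp add: orthonormal_basis_def)
  have "x - (\<Sum>b\<in>B. (x \<bullet> b) *\<^sub>R b) \<in> A"
    using assms(2) unfolding sp[symmetric] by (intro span_diff span_sum span_scale) (auto intro: span_base)
  then have "(x - (\<Sum>b\<in>B. (x \<bullet> b) *\<^sub>R b)) \<bullet> (x - (\<Sum>b\<in>B. (x \<bullet> b) *\<^sub>R b)) = 0"
    by (rule orthonormal_residual[OF assms(1)])
  then show ?thesis by simp
qed

section \<open>Composition algebras and Cayley-Dickson doubling\<close>

text \<open>
  The carrier is a subspace of an arbitrary inner product space, while the product is bilinear on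
  the whole space: bilinearity then needs no membership conditions, and only the laws that
  single out the carrier are relativised to \<open>S\<close>.
\<close>

locale composition_algebra =
  fixes S :: "'a::real_inner set" and mult :: "'a \<Rightarrow> 'a \<Rightarrow> 'a" (infixl "\<odot>" 70) and e :: 'a
  assumes subspace_S: "subspace S"
    and bilinear_mult: "bilinear (\<odot>)"
    and mult_closed: "x \<in> S \<Longrightarrow> y \<in> S \<Longrightarrow> x \<odot> y \<in> S"
    and norm_mult: "x \<in> S \<Longrightarrow> y \<in> S \<Longrightarrow> norm (x \<odot> y) = norm x * norm y"
    and unit_closed: "e \<in> S"
    and norm_unit: "norm e = 1"
    and unit_left: "x \<in> S \<Longrightarrow> e \<odot> x = x"
    and unit_right: "x \<in> S \<Longrightarrow> x \<odot> e = x"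
begin

lemmas mult_add_left = bilinear_ladd[OF bilinear_mult]
  and mult_add_right = bilinear_radd[OF bilinear_mult]
  and mult_diff_left = bilinear_lsub[OF bilinear_mult]
  and mult_diff_right = bilinear_rsub[OF bilinear_mult]
  and mult_scale_left = bilinear_lmul[OF bilinear_mult]
  and mult_scale_right = bilinear_rmul[OF bilinear_mult]
  and mult_minus_left = bilinear_lneg[OF bilinear_mult]
  and mult_minus_right = bilinear_rneg[OF bilinear_mult]

lemmas mult_simps = mult_add_left mult_add_right mult_diff_left mult_diff_right
  mult_scale_left mult_scale_right mult_minus_left mult_minus_right

lemmas S_closed = mult_closed unit_closed subspace_add[OF subspace_S] subspace_diff[OF subspace_S]
  subspace_scale[OF subspace_S] subspace_neg[OF subspace_S]

lemma eq_by_inner: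
  assumes "x \<in> S" "y \<in> S" "\<And>z. z \<in> S \<Longrightarrow> x \<bullet> z = y \<bullet> z"
  shows "x = y"
proof -
  have "(x - y) \<bullet> (x - y) = 0"
    using assms(3)[of "x - y"] assms(1,2) by (simp add: S_closed inner_diff_left)
  then show ?thesis by simp
qed

text \<open>
  Polarisation of the multiplicative law of the norm, first in the right factor and then, in the
  next lemma, in both. Together with the unit laws, the second one implies all identities below.
\<close>

lemma inner_mult_left:
  assumes "x \<in> S" "y \<in> S" "z \<in> S"
  shows "(x \<odot> y) \<bullet> (x \<odot> z) = (x \<bullet> x) * (y \<bullet> z)"
proof -
  have sq: "(x \<odot> w) \<bullet> (x \<odot> w) = (x \<bullet> x) * (w \<bullet> w)" if "w \<in> S" for w
    using norm_mult[OF assms(1) that]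
    by (simp add: power_mult_distrib flip: power2_norm_eq_inner)
  from sq[of "y + z"] sq[of y] sq[of z] assms show ?thesis
    by (simp add: S_closed mult_simps inner_simps inner_commute algebra_simps)
qed

lemma inner_mult_exchange:
  assumes "x \<in> S" "y \<in> S" "z \<in> S" "w \<in> S"
  shows "(x \<odot> y) \<bullet> (z \<odot> w) + (x \<odot> w) \<bullet> (z \<odot> y) = 2 * (x \<bullet> z) * (y \<bullet> w)"
proof -
  have "((x + z) \<odot> y) \<bullet> ((x + z) \<odot> w) = ((x + z) \<bullet> (x + z)) * (y \<bullet> w)"
    using assms by (simp add: inner_mult_left S_closed)
  then show ?thesis
    using inner_mult_left[of x y w] inner_mult_left[of z y w] assms
    by (simp add: mult_add_left inner_add_left inner_add_right distrib_right inner_commute[of z x]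
        inner_commute[of "z \<odot> y"])
qed

text \<open>
  The reflection that fixes the unit and negates its orthogonal complement. It turns
  multiplication by \<open>x\<close> into its adjoint, on either side.
\<close>

definition conjugate :: "'a \<Rightarrow> 'a" where
  "conjugate x = (2 * (x \<bullet> e)) *\<^sub>R e - x"

lemma unit_inner_unit: "e \<bullet> e = 1"
  using norm_unit by (simp add: norm_eq_1)

lemma conjugate_closed: "x \<in> S \<Longrightarrow> conjugate x \<in> S"
  by (simp add: conjugate_def S_closed)

lemma conjugate_conjugate: "conjugate (conjugate x) = x"
  by (simp add: conjugate_def inner_simps unit_inner_unit)

lemma conjugate_inner: "conjugate x \<bullet> y = x \<bullet> conjugate y"
  by (simp add: conjugate_def inner_simps inner_commute algebra_simps)

lemma inner_adjoint_left:
  assumes "x \<in> S" "y \<in> S" "z \<in> S"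
  shows "(x \<odot> y) \<bullet> z = y \<bullet> (conjugate x \<odot> z)"
proof -
  have "(x \<odot> y) \<bullet> z + (x \<odot> z) \<bullet> y = 2 * (x \<bullet> e) * (y \<bullet> z)"
    using inner_mult_exchange[of x y e z] assms by (simp only: unit_closed unit_left)
  moreover have "conjugate x \<odot> z = (2 * (x \<bullet> e)) *\<^sub>R z - x \<odot> z"
    using assms by (simp add: conjugate_def mult_diff_left mult_scale_left unit_left)
  ultimately show ?thesis
    by (simp add: inner_diff_right inner_commute)
qed

lemma inner_adjoint_right:
  assumes "x \<in> S" "y \<in> S" "z \<in> S"
  shows "(x \<odot> y) \<bullet> z = x \<bullet> (z \<odot> conjugate y)"
proof -
  have "(x \<odot> y) \<bullet> z + x \<bullet> (z \<odot> y) = 2 * (x \<bullet> z) * (y \<bullet> e)"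
    using inner_mult_exchange[of x y z e] assms by (simp only: unit_closed unit_right)
  moreover have "z \<odot> conjugate y = (2 * (y \<bullet> e)) *\<^sub>R z - z \<odot> y"
    using assms by (simp add: conjugate_def mult_diff_right mult_scale_right unit_right)
  ultimately show ?thesis
    by (simp add: inner_diff_right mult_ac)
qed

lemma conjugate_mult:
  assumes "x \<in> S" "y \<in> S"
  shows "conjugate (x \<odot> y) = conjugate y \<odot> conjugate x"
proof (rule eq_by_inner)
  fix z assume z: "z \<in> S"
  have "(conjugate y \<odot> conjugate x) \<bullet> z = (y \<odot> z) \<bullet> conjugate x"
    using inner_adjoint_left[of "conjugate y" "conjugate x" z] assms z
    by (simp add: conjugate_closed conjugate_conjugate inner_commute)
  also have "\<dots> = y \<bullet> (conjugate x \<odot> conjugate z)"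
    using assms z by (simp add: inner_adjoint_right conjugate_closed)
  also have "\<dots> = (x \<odot> y) \<bullet> conjugate z"
    using assms z by (simp add: inner_adjoint_left conjugate_closed)
  also have "\<dots> = conjugate (x \<odot> y) \<bullet> z"
    by (simp add: conjugate_inner)
  finally show "conjugate (x \<odot> y) \<bullet> z = (conjugate y \<odot> conjugate x) \<bullet> z" by simp
qed (use assms in \<open>simp_all add: conjugate_closed mult_closed\<close>)

text \<open>
  Polarised form of the law \<open>conjugate x \<odot> (x \<odot> z) = (norm x)\<^sup>2 *\<^sub>R z\<close>. For orthogonal \<open>x\<close> and \<open>y\<close>
  the right-hand side vanishes, which is how a factor is moved past an imaginary unit.
\<close>

lemma conjugate_left_exchange:
  assumes "x \<in> S" "y \<in> S" "z \<in> S"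
  shows "conjugate x \<odot> (y \<odot> z) + conjugate y \<odot> (x \<odot> z) = (2 * (x \<bullet> y)) *\<^sub>R z"
proof (rule eq_by_inner)
  fix w assume w: "w \<in> S"
  have "(conjugate x \<odot> (y \<odot> z)) \<bullet> w = (y \<odot> z) \<bullet> (x \<odot> w)"
       "(conjugate y \<odot> (x \<odot> z)) \<bullet> w = (x \<odot> z) \<bullet> (y \<odot> w)"
    using assms w by (simp_all add: inner_adjoint_left[of "conjugate _"] conjugate_closed conjugate_conjugate mult_closed)
  then show "(conjugate x \<odot> (y \<odot> z) + conjugate y \<odot> (x \<odot> z)) \<bullet> w = ((2 * (x \<bullet> y)) *\<^sub>R z) \<bullet> w"
    using inner_mult_exchange[of x z y w] assms w by (simp add: inner_simps inner_commute)
qed (use assms in \<open>simp_all add: conjugate_closed S_closed\<close>)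

lemma conjugate_right_exchange:
  assumes "x \<in> S" "y \<in> S" "z \<in> S"
  shows "(z \<odot> x) \<odot> conjugate y + (z \<odot> y) \<odot> conjugate x = (2 * (x \<bullet> y)) *\<^sub>R z"
proof (rule eq_by_inner)
  fix w assume w: "w \<in> S"
  have "((z \<odot> x) \<odot> conjugate y) \<bullet> w = (z \<odot> x) \<bullet> (w \<odot> y)"
       "((z \<odot> y) \<odot> conjugate x) \<bullet> w = (z \<odot> y) \<bullet> (w \<odot> x)"
    using assms w
    by (simp_all add: inner_adjoint_right[of _ "conjugate _"] conjugate_closed conjugate_conjugate mult_closed)
  then show "((z \<odot> x) \<odot> conjugate y + (z \<odot> y) \<odot> conjugate x) \<bullet> w = ((2 * (x \<bullet> y)) *\<^sub>R z) \<bullet> w"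
    using inner_mult_exchange[of z x w y] assms w by (simp add: inner_simps inner_commute)
qed (use assms in \<open>simp_all add: conjugate_closed S_closed\<close>)

definition subalgebra :: "'a set \<Rightarrow> bool" where
  "subalgebra A \<longleftrightarrow> subspace A \<and> A \<subseteq> S \<and> e \<in> A \<and> (\<forall>x\<in>A. \<forall>y\<in>A. x \<odot> y \<in> A)"

definition double :: "'a set \<Rightarrow> 'a \<Rightarrow> 'a set" where
  "double A j = {a + b \<odot> j |a b. a \<in> A \<and> b \<in> A}"

end

text \<open>
  A vector \<open>j\<close> orthogonal to a subalgebra \<open>A\<close> behaves like a new imaginary unit: every product in
  \<open>A + A \<odot> j\<close> is forced to follow the Cayley-Dickson formula.
\<close>

locale doubling = composition_algebra +
  fixes A :: "'a set" and j :: 'a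
  assumes subalgebra_A: "subalgebra A"
    and j_closed: "j \<in> S"
    and norm_j: "norm j = 1"
    and j_orth: "a \<in> A \<Longrightarrow> a \<bullet> j = 0"
begin

lemma A_subset: "a \<in> A \<Longrightarrow> a \<in> S"
  and A_mult: "a \<in> A \<Longrightarrow> b \<in> A \<Longrightarrow> a \<odot> b \<in> A"
  and A_unit: "e \<in> A"
  and subspace_A: "subspace A"
  using subalgebra_A by (auto simp: subalgebra_def)

lemmas A_add = subspace_add[OF subspace_A]
  and A_diff = subspace_diff[OF subspace_A]
  and A_scale = subspace_scale[OF subspace_A]

lemma A_conjugate: "a \<in> A \<Longrightarrow> conjugate a \<in> A"
  by (simp add: conjugate_def A_diff A_scale A_unit)

lemmas memb = A_subset A_mult A_conjugate j_closed S_closed conjugate_closed A_unit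

lemma conjugate_j: "conjugate j = - j"
  using j_orth[OF A_unit] by (simp add: conjugate_def inner_commute)

lemma inner_j_j: "j \<bullet> j = 1"
  using norm_j by (simp add: norm_eq_1)

lemma inner_A_Aj:
  assumes "a \<in> A" "b \<in> A"
  shows "a \<bullet> (b \<odot> j) = 0"
proof -
  have "a \<bullet> (b \<odot> j) = (conjugate b \<odot> a) \<bullet> j"
    using assms by (simp add: inner_adjoint_left memb conjugate_conjugate)
  then show ?thesis
    using assms by (simp add: j_orth memb)
qed

lemma inner_Aj_Aj:
  assumes "a \<in> A" "b \<in> A"
  shows "(a \<odot> j) \<bullet> (b \<odot> j) = a \<bullet> b"
  using inner_mult_exchange[of a j b j] assms by (simp add: memb inner_j_j)

lemma mult_right_j_j:
  assumes "a \<in> S"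
  shows "(a \<odot> j) \<odot> j = - a"
proof -
  have "- ((a \<odot> j) \<odot> j) + - ((a \<odot> j) \<odot> j) = 2 *\<^sub>R a"
    using conjugate_right_exchange[of j j a] assms
    by (simp only: memb conjugate_j mult_simps inner_j_j mult_1_right)
  then have "2 *\<^sub>R (- ((a \<odot> j) \<odot> j)) = 2 *\<^sub>R a"
    by (simp only: scaleR_2)
  then show ?thesis
    by (simp only: scaleR_cancel_left) (metis add.inverse_inverse zero_neq_numeral)
qed

lemma conjugate_mult_j:
  assumes "a \<in> A"
  shows "conjugate (a \<odot> j) = - (a \<odot> j)"
  using inner_A_Aj[OF A_unit assms] by (simp add: conjugate_def inner_commute)

lemma j_commute:
  assumes "a \<in> A"
  shows "j \<odot> a = conjugate a \<odot> j"
proof -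
  have "conjugate (conjugate a \<odot> j) = conjugate j \<odot> a"
    using assms by (simp add: conjugate_mult memb conjugate_conjugate)
  then show ?thesis
    using assms by (simp add: conjugate_mult_j memb conjugate_j mult_simps)
qed

text \<open>
  The three product rules below apply the exchange identities to \<open>j\<close> and an element of \<open>A\<close>, which
  are orthogonal, or to \<open>j\<close> and an element of \<open>A \<odot> j\<close>.
\<close>

lemma mult_A_Aj:
  assumes "a \<in> A" "b \<in> A"
  shows "a \<odot> (b \<odot> j) = (b \<odot> a) \<odot> j"
proof -
  have "a \<odot> (j \<odot> conjugate b) + conjugate j \<odot> (conjugate a \<odot> conjugate b) = (2 * (conjugate a \<bullet> j)) *\<^sub>R conjugate b"
    using conjugate_left_exchange[of "conjugate a" j "conjugate b"] assms by (simp add: memb conjugate_conjugate)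
  then have "a \<odot> (j \<odot> conjugate b) = j \<odot> (conjugate a \<odot> conjugate b)"
    using assms by (simp add: j_orth memb conjugate_j mult_simps)
  then show ?thesis
    using assms by (simp add: j_commute memb conjugate_conjugate conjugate_mult)
qed

lemma mult_Aj_A:
  assumes "a \<in> A" "b \<in> A"
  shows "(a \<odot> j) \<odot> b = (a \<odot> conjugate b) \<odot> j"
proof -
  have "(a \<odot> j) \<odot> b + (a \<odot> conjugate b) \<odot> conjugate j = 0"
    using conjugate_right_exchange[of j "conjugate b" a] assms j_orth[of "conjugate b"]
    by (simp add: memb conjugate_conjugate inner_commute)
  then show ?thesis
    by (simp add: conjugate_j mult_simps)
qed

lemma mult_Aj_Aj:
  assumes "a \<in> A" "b \<in> A"
  shows "(a \<odot> j) \<odot> (b \<odot> j) = - (conjugate b \<odot> a)"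
proof -
  have "(a \<odot> j) \<odot> conjugate (b \<odot> j) + (a \<odot> (b \<odot> j)) \<odot> conjugate j = (2 * (j \<bullet> (b \<odot> j))) *\<^sub>R a"
    using assms by (intro conjugate_right_exchange) (simp_all add: memb)
  moreover have "j \<bullet> (b \<odot> j) = b \<bullet> e"
    using inner_Aj_Aj[OF A_unit assms(2)] by (simp add: unit_left memb inner_commute)
  moreover have "(a \<odot> (b \<odot> j)) \<odot> j = - (b \<odot> a)"
    using assms by (simp add: mult_A_Aj mult_right_j_j memb)
  ultimately have "(a \<odot> j) \<odot> (b \<odot> j) = b \<odot> a - (2 * (b \<bullet> e)) *\<^sub>R a"
    using assms by (simp add: conjugate_mult_j conjugate_j mult_minus_right algebra_simps)
  then show ?thesis
    using assms by (simp add: conjugate_def mult_diff_left mult_scale_left unit_left memb)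
qed

lemma double_mult:
  assumes "a \<in> A" "b \<in> A" "c \<in> A" "d \<in> A"
  shows "(a + b \<odot> j) \<odot> (c + d \<odot> j) = (a \<odot> c - conjugate d \<odot> b) + (d \<odot> a + b \<odot> conjugate c) \<odot> j"
  using assms by (simp add: mult_add_left mult_add_right mult_A_Aj mult_Aj_A mult_Aj_Aj algebra_simps)

lemma A_subset_double: "A \<subseteq> double A j"
proof
  fix a assume "a \<in> A"
  then have "a = a + 0 \<odot> j" "a \<in> A" "0 \<in> A"
    by (simp_all add: bilinear_lzero[OF bilinear_mult] subspace_0[OF subspace_A])
  then show "a \<in> double A j" unfolding double_def by blast
qed

lemma Aj_subset_double: "a \<in> A \<Longrightarrow> a \<odot> j \<in> double A j"
  using subspace_0[OF subspace_A] unfolding double_def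
  by (intro CollectI exI[of _ 0] exI[of _ a]) simp

lemma double_subalgebra: "subalgebra (double A j)"
  unfolding subalgebra_def
proof (intro conjI ballI)
  have "double A j = {x + y |x y. x \<in> A \<and> y \<in> (\<lambda>b. b \<odot> j) ` A}"
    by (auto simp: double_def)
  moreover have "linear (\<lambda>b. b \<odot> j)"
    using bilinear_mult by (simp add: bilinear_def)
  ultimately show "subspace (double A j)"
    by (simp add: subspace_sums subspace_A linear_subspace_image)
  show "double A j \<subseteq> S"
    by (auto simp: double_def memb)
  show "e \<in> double A j"
    using A_subset_double A_unit by blast
  fix x y assume "x \<in> double A j" "y \<in> double A j"
  then obtain a b c d where *: "a \<in> A" "b \<in> A" "c \<in> A" "d \<in> A" "x = a + b \<odot> j" "y = c + d \<odot> j"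
    by (auto simp: double_def)
  then have "a \<odot> c - conjugate d \<odot> b \<in> A" "d \<odot> a + b \<odot> conjugate c \<in> A"
    by (simp_all add: A_diff A_add memb)
  then show "x \<odot> y \<in> double A j"
    unfolding double_def using * double_mult[of a b c d] by blast
qed

text \<open>
  The exchange identity for \<open>b\<close>, \<open>c\<close>, \<open>d \<odot> j\<close>, \<open>a \<odot> j\<close> has right-hand side zero because \<open>A\<close> and
  \<open>A \<odot> j\<close> are orthogonal, and evaluating its left-hand side by the doubling formulas gives
  associativity tested against an arbitrary element of \<open>A\<close>. So only an associative subalgebra
  leaves room for a further imaginary unit.
\<close>

lemma associative_A:
  assumes "a \<in> A" "b \<in> A" "c \<in> A"
  shows "(a \<odot> b) \<odot> c = a \<odot> (b \<odot> c)"
proof (rule eq_by_inner)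
  have inner: "((a \<odot> b) \<odot> c) \<bullet> d = (a \<odot> (b \<odot> c)) \<bullet> d" if d: "d \<in> A" for d
  proof -
    have "(b \<odot> c) \<bullet> ((d \<odot> j) \<odot> (a \<odot> j)) + (b \<odot> (a \<odot> j)) \<bullet> ((d \<odot> j) \<odot> c) = 0"
      using inner_mult_exchange[of b c "d \<odot> j" "a \<odot> j"] assms d by (simp add: memb inner_A_Aj)
    then have "(b \<odot> c) \<bullet> (conjugate a \<odot> d) = (a \<odot> b) \<bullet> (d \<odot> conjugate c)"
      using assms d by (simp add: mult_Aj_Aj mult_A_Aj mult_Aj_A inner_Aj_Aj memb)
    then show ?thesis
      using assms d by (simp add: inner_adjoint_left[of a] inner_adjoint_right[of "a \<odot> b"] memb)
  qed
  fix z assume "z \<in> S"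
  have "((a \<odot> b) \<odot> c - a \<odot> (b \<odot> c)) \<bullet> ((a \<odot> b) \<odot> c - a \<odot> (b \<odot> c)) = 0"
    using inner[of "(a \<odot> b) \<odot> c - a \<odot> (b \<odot> c)"] assms by (simp add: A_diff memb inner_diff_left)
  then show "((a \<odot> b) \<odot> c) \<bullet> z = (a \<odot> (b \<odot> c)) \<bullet> z" by simp
qed (use assms in \<open>simp_all add: memb\<close>)

lemma right_j_cancel:
  assumes "a \<in> A" "b \<in> A" "a \<odot> j = b \<odot> j"
  shows "a = b"
  using assms by (metis A_subset mult_right_j_j neg_equal_iff_equal)

text \<open>
  In the double, \<open>a \<odot> (b \<odot> j)\<close> equals \<open>(b \<odot> a) \<odot> j\<close>; if the double is associative it also equals
  \<open>(a \<odot> b) \<odot> j\<close>.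
\<close>

lemma commutative_A:
  assumes "\<And>x y z. x \<in> double A j \<Longrightarrow> y \<in> double A j \<Longrightarrow> z \<in> double A j \<Longrightarrow>
      (x \<odot> y) \<odot> z = x \<odot> (y \<odot> z)"
    and "a \<in> A" "b \<in> A"
  shows "a \<odot> b = b \<odot> a"
proof -
  have "j \<in> double A j"
    using Aj_subset_double[OF A_unit] by (simp add: unit_left memb)
  then have "(a \<odot> b) \<odot> j = a \<odot> (b \<odot> j)"
    using assms A_subset_double by blast
  then show ?thesis
    using assms(2,3) by (intro right_j_cancel[of "a \<odot> b" "b \<odot> a"]) (simp_all add: mult_A_Aj memb)
qed

text \<open>
  In the double, \<open>j \<odot> a\<close> equals \<open>conjugate a \<odot> j\<close>, so commutativity forces \<open>conjugate a = a\<close>.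
\<close>

lemma conjugate_trivial_A:
  assumes "\<And>x y. x \<in> double A j \<Longrightarrow> y \<in> double A j \<Longrightarrow> x \<odot> y = y \<odot> x"
    and "a \<in> A"
  shows "conjugate a = a"
proof -
  have "j \<in> double A j"
    using Aj_subset_double[OF A_unit] by (simp add: unit_left memb)
  then have "j \<odot> a = a \<odot> j"
    using assms A_subset_double by blast
  then show ?thesis
    using assms(2) by (intro right_j_cancel[of "conjugate a" a]) (simp_all add: j_commute memb)
qed


lemma double_basis:
  assumes "orthonormal_basis B A"
  shows "orthonormal_basis (B \<union> (\<lambda>b. b \<odot> j) ` B) (double A j)"
    and "card (B \<union> (\<lambda>b. b \<odot> j) ` B) = 2 * card B"
proof -
  let ?Bj = "(\<lambda>b. b \<odot> j) ` B"
  have B: "finite B" "pairwise orthogonal B" "\<And>b. b \<in> B \<Longrightarrow> norm b = 1" "span B = A" "\<And>b. b \<in> B \<Longrightarrow> b \<in> A"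
    using assms span_superset[of B] by (auto simp: orthonormal_basis_def)
  have lin: "linear (\<lambda>b. b \<odot> j)"
    using bilinear_mult by (simp add: bilinear_def)
  have "span (B \<union> ?Bj) = {x + y |x y. x \<in> A \<and> y \<in> (\<lambda>b. b \<odot> j) ` A}"
    by (simp add: span_Un linear_span_image[OF lin] B)
  then have sp: "span (B \<union> ?Bj) = double A j"
    by (auto simp: double_def)
  have "orthogonal x y" if xy: "x \<in> B \<union> ?Bj" "y \<in> B \<union> ?Bj" "x \<noteq> y" for x y
  proof -
    have BB: "a \<bullet> b = 0" if "a \<in> B" "b \<in> B" "a \<noteq> b" for a b
      using B(2) that by (auto simp: pairwise_def orthogonal_def)
    have BBj: "a \<bullet> (b \<odot> j) = 0" "(b \<odot> j) \<bullet> a = 0" if "a \<in> B" "b \<in> B" for a b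
      using inner_A_Aj[of a b] B(5) that by (simp_all add: inner_commute)
    have BjBj: "(a \<odot> j) \<bullet> (b \<odot> j) = 0" if "a \<in> B" "b \<in> B" "a \<odot> j \<noteq> b \<odot> j" for a b
      using inner_Aj_Aj[of a b] BB[of a b] B(5) that by auto
    show ?thesis
      using xy BB BBj BjBj unfolding orthogonal_def by blast
  qed
  then have "pairwise orthogonal (B \<union> ?Bj)"
    by (simp add: pairwise_def)
  moreover have "norm (b \<odot> j) = 1" if "b \<in> B" for b
    using B that by (simp add: norm_mult norm_j memb)
  ultimately show "orthonormal_basis (B \<union> ?Bj) (double A j)"
    using B sp by (auto simp: orthonormal_basis_def)
  have "B \<inter> ?Bj = {}"
  proof (safe, simp)
    fix b assume b: "b \<in> B" "b \<odot> j \<in> B"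
    have "(b \<odot> j) \<bullet> (b \<odot> j) = 0"
      using B b by (intro inner_A_Aj) auto
    then show False
      using B(3)[OF b(2)] by simp
  qed
  moreover have "inj_on (\<lambda>b. b \<odot> j) B"
    by (rule inj_onI) (use B right_j_cancel in blast)
  ultimately show "card (B \<union> ?Bj) = 2 * card B"
    using B(1) by (simp add: card_Un_disjoint card_image)
qed

end

context composition_algebra
begin

text \<open>
  The new imaginary unit is the normalised component, orthogonal to \<open>A\<close>, of any vector outside \<open>A\<close>.
\<close>

lemma doubling_exists:
  assumes A: "subalgebra A" and B: "orthonormal_basis B A" and "A \<noteq> S"
  obtains j where "doubling S (\<odot>) e A j"
proof -
  obtain x where x: "x \<in> S" "x \<notin> A"
    using assms by (auto simp: subalgebra_def)
  define p where "p = (\<Sum>b\<in>B. (x \<bullet> b) *\<^sub>R b)"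
  have "p \<in> A"
    using B unfolding p_def orthonormal_basis_def by (auto intro!: span_sum span_scale intro: span_base)
  then have p: "p \<in> S" "x - p \<noteq> 0"
    using A x by (auto simp: subalgebra_def)
  define j where "j = (1 / norm (x - p)) *\<^sub>R (x - p)"
  have "doubling S (\<odot>) e A j"
  proof unfold_locales
    show "subalgebra A" by fact
    show "j \<in> S" using x p by (simp add: j_def S_closed)
    show "norm j = 1" using p by (simp add: j_def)
    show "a \<bullet> j = 0" if "a \<in> A" for a
      using orthonormal_residual[OF B that, of x] by (simp add: j_def p_def)
  qed
  then show ?thesis by (rule that)
qed

lemma subalgebra_unit_span: "subalgebra (span {e})"
proof -
  have "span {e} \<subseteq> S"
    by (simp add: span_minimal subspace_S unit_closed)
  moreover have "x \<odot> y \<in> span {e}" if "x \<in> span {e}" "y \<in> span {e}" for x y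
    using that by (auto simp: span_singleton mult_simps unit_left unit_closed)
  ultimately show ?thesis
    by (simp add: subalgebra_def span_base)
qed

text \<open>
  Start from the line spanned by the unit and double as long as the subalgebra is proper. Each
  doubling destroys one property: the first double contains \<open>j0\<close>, which conjugation negates, so
  the second is not commutative and the third is not associative. A proper subalgebra is
  associative, hence the third double, of dimension eight, must be everything.
\<close>

theorem dimension:
  assumes B: "orthonormal_basis B S"
  shows "card B \<in> {1, 2, 4, 8}"
proof -
  define B0 A0 where "B0 = {e}" and "A0 = span {e}"
  have A0: "subalgebra A0" "orthonormal_basis B0 A0" "card B0 = 1"
    using subalgebra_unit_span by (simp_all add: B0_def A0_def orthonormal_basis_def norm_unit)
  have card_B: "card B = card C" if "orthonormal_basis C S" for C
    using orthonormal_basis_card_unique[OF B that] .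
  show ?thesis
  proof (cases "A0 = S")
    case True
    then show ?thesis using A0 card_B by auto
  next
    case False
    then obtain j0 where "doubling S (\<odot>) e A0 j0"
      using A0 doubling_exists by blast
    then interpret D0: doubling S "(\<odot>)" e A0 j0 .
    define A1 where "A1 = double A0 j0"
    obtain B1 where A1: "subalgebra A1" "orthonormal_basis B1 A1" "card B1 = 2"
      using D0.double_subalgebra D0.double_basis[OF A0(2)] A0(3) unfolding A1_def by auto
    have j0: "j0 \<in> A1"
      using D0.Aj_subset_double[OF D0.A_unit] by (simp add: A1_def unit_left D0.j_closed)
    have j0_conj: "conjugate j0 \<noteq> j0"
    proof
      assume "conjugate j0 = j0"
      then have "j0 \<bullet> j0 = - (j0 \<bullet> j0)"
        using D0.conjugate_j by (metis inner_minus_left)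
      then show False
        using D0.inner_j_j by simp
    qed
    show ?thesis
    proof (cases "A1 = S")
      case True
      then show ?thesis using A1 card_B by auto
    next
      case False
      then obtain j1 where "doubling S (\<odot>) e A1 j1"
        using A1 doubling_exists by blast
      then interpret D1: doubling S "(\<odot>)" e A1 j1 .
      define A2 where "A2 = double A1 j1"
      obtain B2 where A2: "subalgebra A2" "orthonormal_basis B2 A2" "card B2 = 4"
        using D1.double_subalgebra D1.double_basis[OF A1(2)] A1(3) unfolding A2_def by auto
      show ?thesis
      proof (cases "A2 = S")
        case True
        then show ?thesis using A2 card_B by auto
      next
        case False
        then obtain j2 where "doubling S (\<odot>) e A2 j2"
          using A2 doubling_exists by blast
        then interpret D2: doubling S "(\<odot>)" e A2 j2 .
        define A3 where "A3 = double A2 j2"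
        obtain B3 where A3: "subalgebra A3" "orthonormal_basis B3 A3" "card B3 = 8"
          using D2.double_subalgebra D2.double_basis[OF A2(2)] A2(3) unfolding A3_def by auto
        have "A3 = S"
        proof (rule ccontr)
          assume "A3 \<noteq> S"
          then obtain j3 where "doubling S (\<odot>) e A3 j3"
            using A3 doubling_exists by blast
          then interpret D3: doubling S "(\<odot>)" e A3 j3 .
          have "x \<odot> y = y \<odot> x" if "x \<in> A2" "y \<in> A2" for x y
            using D2.commutative_A[OF _ that] D3.associative_A by (simp add: A3_def)
          then have "conjugate j0 = j0"
            using D1.conjugate_trivial_A[OF _ j0] by (simp add: A2_def)
          then show False
            using j0_conj by simp
        qed
        then show ?thesis using A3 card_B by auto
      qed
    qed
  qed
qed

end

section \<open>Hurwitz's theorem\<close>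

text \<open>
  A product without unit is changed into one with unit by Kaplansky's trick. For a unit vector \<open>u\<close>
  the maps \<open>y \<mapsto> u \<odot> y\<close> and \<open>x \<mapsto> x \<odot> u\<close> are isometries of \<open>S\<close>; with their inverses \<open>L\<close> and \<open>R\<close>
  the product \<open>R x \<odot> L y\<close> has unit \<open>u \<odot> u\<close> and still multiplies norms.
\<close>

theorem hurwitz:
  fixes mult :: "'a::real_inner \<Rightarrow> 'a \<Rightarrow> 'a" (infixl "\<odot>" 70)
  assumes B: "orthonormal_basis B S" and "S \<noteq> {0}"
    and bil: "bilinear (\<odot>)"
    and closed: "\<And>x y. x \<in> S \<Longrightarrow> y \<in> S \<Longrightarrow> x \<odot> y \<in> S"
    and norm_mult: "\<And>x y. x \<in> S \<Longrightarrow> y \<in> S \<Longrightarrow> norm (x \<odot> y) = norm x * norm y"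
  shows "card B \<in> {1, 2, 4, 8}"
proof -
  have sub: "subspace S" and fin: "finite B" and BS: "B \<subseteq> S"
    using B span_superset[of B] subspace_span[of B] by (auto simp: orthonormal_basis_def)
  obtain u where u: "u \<in> S" "norm u = 1"
  proof -
    have "B \<noteq> {}" using B \<open>S \<noteq> {0}\<close> by (auto simp: orthonormal_basis_def)
    then show thesis using B BS that by (auto simp: orthonormal_basis_def)
  qed
  \<comment> \<open>The adjoint of an isometry of \<open>S\<close> is its inverse. Written with the basis, it is linear on the
    whole space, as the locale demands.\<close>
  define adj where "adj T y = (\<Sum>b\<in>B. (y \<bullet> T b) *\<^sub>R b)" for T :: "'a \<Rightarrow> 'a" and y
  have adj: "linear (adj T)" "\<And>y. adj T y \<in> S"
      "\<And>y. y \<in> S \<Longrightarrow> T (adj T y) = y" "\<And>x. x \<in> S \<Longrightarrow> adj T (T x) = x"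
      "\<And>y. y \<in> S \<Longrightarrow> norm (adj T y) = norm y"
    if T: "linear T" "\<And>x. x \<in> S \<Longrightarrow> T x \<in> S" "\<And>x. x \<in> S \<Longrightarrow> norm (T x) = norm x" for T
  proof -
    show "linear (adj T)"
      unfolding adj_def
      by (rule linearI) (simp_all add: inner_add_left scaleR_add_left sum.distrib scaleR_sum_right)
    show adjS: "adj T y \<in> S" for y
      using BS unfolding adj_def by (intro subspace_sum[OF sub] subspace_scale[OF sub]) auto
    have inner_T: "T x \<bullet> T y = x \<bullet> y" if "x \<in> S" "y \<in> S" for x y
    proof -
      have "norm (T (x + y)) = norm (x + y)"
        using that by (simp add: T(3) subspace_add[OF sub])
      then have "T (x + y) \<bullet> T (x + y) = (x + y) \<bullet> (x + y)"
        by (simp flip: power2_norm_eq_inner)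
      moreover have "T x \<bullet> T x = x \<bullet> x" "T y \<bullet> T y = y \<bullet> y"
        using T(3) that by (simp_all flip: power2_norm_eq_inner)
      ultimately show ?thesis
        by (simp add: linear_add[OF T(1)] inner_add_left inner_add_right inner_commute)
    qed
    show adjT: "adj T (T x) = x" if "x \<in> S" for x
      using orthonormal_expansion[OF B that] BS that by (simp add: adj_def inner_T subset_iff)
    have inj: "inj_on T B"
      using adjT BS by (metis inj_on_inverseI subset_iff)
    have "orthonormal_basis (T ` B) (span (T ` B))"
      using B BS T(3) inner_T
      by (auto simp: orthonormal_basis_def pairwise_def orthogonal_def subset_iff)
    \<comment> \<open>An isometry preserves the dimension, so the image of the basis spans \<open>S\<close>.\<close>
    moreover have "span (T ` B) = S"
    proof (rule ccontr)
      assume ne: "span (T ` B) \<noteq> S"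
      have "span (T ` B) \<subseteq> S"
        using BS T(2) by (intro span_minimal[OF _ sub]) auto
      then obtain x where x: "x \<in> S" "x \<notin> span (T ` B)" using ne by blast
      then have "independent (insert x (T ` B))"
        using orthonormal_basis_independent[OF calculation]
        by (simp add: independent_insert span_base)
      moreover have "insert x (T ` B) \<subseteq> span B"
        using B BS T(2) x by (auto simp: orthonormal_basis_def)
      ultimately have "card (insert x (T ` B)) \<le> card B"
        using independent_span_bound[OF fin] by blast
      then show False
        using x span_base[of x "T ` B"] fin card_image[OF inj]
        by (cases "x \<in> T ` B") simp_all
    qed
    ultimately have TB: "orthonormal_basis (T ` B) S" by simp
    show TadjT: "T (adj T y) = y" if "y \<in> S" for y
      using orthonormal_expansion[OF TB that]
      by (simp add: adj_def linear_sum[OF T(1)] linear_scale[OF T(1)] sum.reindex[OF inj])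
    show "norm (adj T y) = norm y" if "y \<in> S" for y
      using T(3)[OF adjS[of y]] TadjT[OF that] by simp
  qed
  define L R where "L = adj (\<lambda>y. u \<odot> y)" and "R = adj (\<lambda>x. x \<odot> u)"
  have lin: "linear (\<lambda>y. x \<odot> y)" "linear (\<lambda>x. x \<odot> y)" for x y
    using bil by (auto simp: bilinear_def)
  note L = adj[of "\<lambda>y. u \<odot> y", folded L_def]
  note R = adj[of "\<lambda>x. x \<odot> u", folded R_def]
  have L: "linear L" "\<And>y. L y \<in> S" "\<And>y. y \<in> S \<Longrightarrow> u \<odot> L y = y"
      "\<And>y. y \<in> S \<Longrightarrow> L (u \<odot> y) = y" "\<And>y. y \<in> S \<Longrightarrow> norm (L y) = norm y"
    using L lin closed norm_mult u by simp_all
  have R: "linear R" "\<And>y. R y \<in> S" "\<And>y. y \<in> S \<Longrightarrow> R y \<odot> u = y"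
      "\<And>y. y \<in> S \<Longrightarrow> R (y \<odot> u) = y" "\<And>y. y \<in> S \<Longrightarrow> norm (R y) = norm y"
    using R lin closed norm_mult u by simp_all
  interpret composition_algebra S "\<lambda>x y. R x \<odot> L y" "u \<odot> u"
  proof
    show "bilinear (\<lambda>x y. R x \<odot> L y)"
      unfolding bilinear_def
      using linear_compose[OF L(1) lin(1)] linear_compose[OF R(1) lin(2)] by (simp add: o_def)
  qed (simp_all add: sub closed norm_mult u L R)
  show ?thesis by (rule dimension[OF B])
qed

section \<open>Tensors as multilinear forms\<close>

lemma multi_indices_Nil: "multi_indices [] = {[]}"
  by (auto simp: multi_indices_def)

lemma multi_indices_Cons:
  "multi_indices (n # ns) = (\<lambda>(i, is). i # is) ` ({..<n} \<times> multi_indices ns)"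
  by (auto simp: multi_indices_def list_all2_Cons2 image_iff)

lemma finite_multi_indices: "finite (multi_indices ns)"
  by (induction ns) (simp_all add: multi_indices_Nil multi_indices_Cons)

lemma Cons_in_multi_indices [simp]:
  "i # is \<in> multi_indices (n # ns) \<longleftrightarrow> i < n \<and> is \<in> multi_indices ns"
  by (simp add: multi_indices_def)

lemma sum_multi_indices_Cons:
  "(\<Sum>is\<in>multi_indices (n # ns). f is) = (\<Sum>i<n. \<Sum>is\<in>multi_indices ns. f (i # is))"
proof -
  have "inj_on (\<lambda>(i, is). i # is) ({..<n} \<times> multi_indices ns)"
    by (auto simp: inj_on_def)
  then show ?thesis
    by (simp add: multi_indices_Cons sum.reindex sum.cartesian_product case_prod_unfold)
qed

lemma frobenius_inner_Nil: "frobenius_inner [] X Y = X [] * Y []"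
  by (simp add: frobenius_inner_def multi_indices_Nil)

lemma frobenius_inner_Cons:
  "frobenius_inner (n # ns) X Y =
     (\<Sum>i<n. frobenius_inner ns (\<lambda>is. X (i # is)) (\<lambda>is. Y (i # is)))"
  by (simp add: frobenius_inner_def sum_multi_indices_Cons)

lemma frobenius_norm_sq: "(frobenius_norm ns X)\<^sup>2 = frobenius_inner ns X X"
  by (simp add: frobenius_norm_def frobenius_inner_def L2_set_def sum_nonneg power2_eq_square)

lemma frobenius_norm_nonneg: "0 \<le> frobenius_norm ns X"
  by (simp add: frobenius_norm_def)

lemma frobenius_norm_sq_Cons:
  "(frobenius_norm (n # ns) X)\<^sup>2 = (\<Sum>i<n. (frobenius_norm ns (\<lambda>is. X (i # is)))\<^sup>2)"
  by (simp add: frobenius_norm_sq frobenius_inner_Cons)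

lemma frobenius_inner_commute: "frobenius_inner ns X Y = frobenius_inner ns Y X"
  by (simp add: frobenius_inner_def mult.commute)

lemma frobenius_inner_sum_left:
  "frobenius_inner ns (\<lambda>is. \<Sum>i\<in>I. c i * X i is) Y = (\<Sum>i\<in>I. c i * frobenius_inner ns (X i) Y)"
  unfolding frobenius_inner_def sum_distrib_right sum_distrib_left
  by (subst sum.swap) (simp add: mult_ac)

lemma frobenius_inner_sum_right:
  "frobenius_inner ns Y (\<lambda>is. \<Sum>i\<in>I. c i * X i is) = (\<Sum>i\<in>I. c i * frobenius_inner ns Y (X i))"
  by (subst (1 2) frobenius_inner_commute) (rule frobenius_inner_sum_left)

lemma unit_vector_iff: "unit_vector n u \<longleftrightarrow> (\<Sum>i<n. (u i)\<^sup>2) = 1"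
  by (simp add: unit_vector_def L2_set_def)

definition unit_family :: "nat list \<Rightarrow> (nat \<Rightarrow> nat \<Rightarrow> real) \<Rightarrow> bool" where
  "unit_family ns u \<longleftrightarrow> (\<forall>k<length ns. unit_vector (ns ! k) (u k))"

lemma unit_family_Nil: "unit_family [] u"
  by (simp add: unit_family_def)

lemma unit_family_Cons:
  "unit_family (n # ns) u \<longleftrightarrow> unit_vector n (u 0) \<and> unit_family ns (\<lambda>k. u (Suc k))"
  by (auto simp: unit_family_def less_Suc_eq_0_disj)

definition multilinear_form :: "nat list \<Rightarrow> (nat list \<Rightarrow> real) \<Rightarrow> (nat \<Rightarrow> nat \<Rightarrow> real) \<Rightarrow> real" where
  "multilinear_form ns X u = frobenius_inner ns X (elementary_tensor ns u)"

lemma multilinear_form_Nil: "multilinear_form [] X u = X []"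
  by (simp add: multilinear_form_def frobenius_inner_Nil elementary_tensor_def multi_indices_Nil)

lemma elementary_tensor_Cons:
  assumes "i < n"
  shows "elementary_tensor (n # ns) u (i # is) =
    u 0 i * elementary_tensor ns (\<lambda>k. u (Suc k)) is"
  using assms by (simp add: elementary_tensor_def prod.lessThan_Suc_shift del: prod.lessThan_Suc)

lemma multilinear_form_Cons:
  "multilinear_form (n # ns) X u =
     multilinear_form ns (contract_first n X (u 0)) (\<lambda>k. u (Suc k))"
proof -
  let ?E = "elementary_tensor ns (\<lambda>k. u (Suc k))"
  have "multilinear_form (n # ns) X u =
      (\<Sum>i<n. frobenius_inner ns (\<lambda>is. X (i # is)) (\<lambda>is. u 0 i * ?E is))"
    unfolding multilinear_form_def frobenius_inner_Cons
    by (rule sum.cong) (simp_all add: elementary_tensor_Cons)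
  also have "\<dots> = (\<Sum>i<n. u 0 i * frobenius_inner ns (\<lambda>is. X (i # is)) ?E)"
    by (simp add: frobenius_inner_def sum_distrib_left mult_ac)
  finally show ?thesis
    by (simp add: multilinear_form_def contract_first_def frobenius_inner_sum_left)
qed

lemma frobenius_norm_contract:
  "(frobenius_norm ns (contract_first n X u))\<^sup>2 =
     (\<Sum>i<n. \<Sum>j<n. u i * u j * frobenius_inner ns (\<lambda>is. X (i # is)) (\<lambda>is. X (j # is)))"
  by (simp add: frobenius_norm_sq contract_first_def frobenius_inner_sum_left
      frobenius_inner_sum_right sum_distrib_left mult_ac)

definition std_vec :: "nat \<Rightarrow> nat \<Rightarrow> real" where
  "std_vec i = (\<lambda>k. of_bool (k = i))"

lemma unit_std_vec: "i < n \<Longrightarrow> unit_vector n (std_vec i)"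
  by (simp add: unit_vector_iff std_vec_def of_bool_def if_distrib[of "\<lambda>x. x\<^sup>2"] cong: if_cong)

lemma contract_std_vec: "i < n \<Longrightarrow> contract_first n X (std_vec i) = (\<lambda>is. X (i # is))"
  by (simp add: contract_first_def std_vec_def of_bool_def if_distrib[of "\<lambda>x. x * _"] cong: if_cong)

text \<open>
  If \<open>G\<close> is bounded by \<open>c\<close> on the unit sphere and its trace attains the maximum \<open>n * c\<close>, then all
  diagonal entries equal \<open>c\<close>. The form \<open>c I - G\<close> is then nonnegative with zero diagonal, and its values
  at \<open>(e\<^sub>i \<plusminus> e\<^sub>j) / sqrt 2\<close> show that the other entries vanish, so \<open>G = c I\<close>.
\<close>

lemma quadratic_form_constant:
  fixes G :: "nat \<Rightarrow> nat \<Rightarrow> real"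
  assumes sym: "\<And>i j. G i j = G j i"
    and le: "\<And>u. unit_vector n u \<Longrightarrow> (\<Sum>i<n. \<Sum>j<n. u i * u j * G i j) \<le> c"
    and trace: "(\<Sum>i<n. G i i) = real n * c"
    and u: "unit_vector n u"
  shows "(\<Sum>i<n. \<Sum>j<n. u i * u j * G i j) = c"
proof -
  have std: "(\<Sum>k<n. std_vec i k * f k) = f i" if "i < n" for i and f :: "nat \<Rightarrow> real"
    using that by (simp add: std_vec_def of_bool_def if_distrib[of "\<lambda>x. x * _"] cong: if_cong)
  have form_std: "(\<Sum>k<n. \<Sum>l<n. std_vec i k * std_vec j l * G k l) = G i j"
    if "i < n" "j < n" for i j
    using that by (simp add: mult.assoc std flip: sum_distrib_left)
  have diag_le: "G i i \<le> c" if "i < n" for i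
    using le[OF unit_std_vec[OF that]] form_std that by simp
  have "(\<Sum>i<n. c - G i i) = 0"
    using trace by (simp add: sum_subtractf)
  then have diag: "G i i = c" if "i < n" for i
    using sum_nonneg_eq_0_iff[of "{..<n}" "\<lambda>i. c - G i i"] diag_le that by force
  have off_le: "s * G i j \<le> 0" if ij: "i < n" "j < n" "i \<noteq> j" and s: "s\<^sup>2 = 1" for i j and s :: real
  proof -
    define v where "v = (\<lambda>k. (std_vec i k + s * std_vec j k) / sqrt 2)"
    have "(\<Sum>k<n. (v k)\<^sup>2) = (\<Sum>k<n. (std_vec i k * std_vec i k + 2 * s * (std_vec i k * std_vec j k)
        + s\<^sup>2 * (std_vec j k * std_vec j k)) / 2)"
      by (rule sum.cong) (simp_all add: v_def power_divide power2_eq_square algebra_simps)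
    also have "\<dots> = ((\<Sum>k<n. std_vec i k * std_vec i k) + 2 * s * (\<Sum>k<n. std_vec i k * std_vec j k)
        + s\<^sup>2 * (\<Sum>k<n. std_vec j k * std_vec j k)) / 2"
      by (simp only: sum.distrib sum_distrib_left flip: sum_divide_distrib)
    also have "\<dots> = 1"
      using ij s by (simp add: std) (simp add: std_vec_def)
    finally have "unit_vector n v" by (simp add: unit_vector_iff)
    then have "(\<Sum>k<n. \<Sum>l<n. v k * v l * G k l) \<le> c" by (rule le)
    also have "(\<Sum>k<n. \<Sum>l<n. v k * v l * G k l) =
       (\<Sum>k<n. \<Sum>l<n. (std_vec i k * std_vec i l * G k l + s * (std_vec i k * std_vec j l * G k l)
          + s * (std_vec j k * std_vec i l * G k l) + s\<^sup>2 * (std_vec j k * std_vec j l * G k l)) / 2)"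
      by (intro sum.cong refl) (simp add: v_def power2_eq_square algebra_simps)
    also have "\<dots> = (G i i + s * G i j + s * G j i + s\<^sup>2 * G j j) / 2"
      using ij by (simp add: sum.distrib form_std flip: sum_distrib_left sum_divide_distrib)
    finally show ?thesis
      using ij s by (simp add: diag sym[of j i])
  qed
  have off: "G i j = 0" if "i < n" "j < n" "i \<noteq> j" for i j
    using off_le[OF that, of 1] off_le[OF that, of "-1"] by simp
  have "(\<Sum>j<n. u i * u j * G i j) = c * (u i)\<^sup>2" if "i < n" for i
  proof -
    have "(\<Sum>j<n. u i * u j * G i j) = (\<Sum>j<n. if j = i then c * (u i)\<^sup>2 else 0)"
      using that by (intro sum.cong) (auto simp: diag off power2_eq_square)
    then show ?thesis using that by simp
  qed
  then have "(\<Sum>i<n. \<Sum>j<n. u i * u j * G i j) = c * (\<Sum>i<n. (u i)\<^sup>2)"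
    by (simp add: sum_distrib_left)
  then show ?thesis using u by (simp add: unit_vector_iff)
qed

section \<open>Orthogonality and extremal spectral norm\<close>

lemma frobenius_singleton: "(frobenius_norm [n] X)\<^sup>2 = (\<Sum>i<n. (X [i])\<^sup>2)"
  unfolding frobenius_norm_sq by (simp add: frobenius_inner_Cons frobenius_inner_Nil power2_eq_square)

lemma multilinear_form_singleton: "multilinear_form [n] X u = (\<Sum>i<n. u 0 i * X [i])"
  by (simp add: multilinear_form_Cons multilinear_form_Nil contract_first_def)

lemma orthogonal_tensor_Cons:
  assumes "ns \<noteq> []"
  shows "orthogonal_tensor (n # ns) X \<longleftrightarrow>
    (\<forall>u. unit_vector n u \<longrightarrow> orthogonal_tensor ns (contract_first n X u))"
  using assms by (cases ns) simp_all

lemma form_bound_contract: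
  assumes "\<And>w. unit_family (n # ns) w \<Longrightarrow> \<bar>multilinear_form (n # ns) X w\<bar> \<le> s"
    and "unit_vector n u" "unit_family ns w"
  shows "\<bar>multilinear_form ns (contract_first n X u) w\<bar> \<le> s"
  using assms(1)[of "case_nat u w"] assms(2,3)
  by (simp add: unit_family_Cons multilinear_form_Cons)

text \<open>
  Induction on the order: the slices at the first index are contractions with standard basis
  vectors, so they inherit the bound on the form, and the square of the Frobenius norm is additive
  over them. At order one the bound is tested on the normalised vector itself.
\<close>

lemma frobenius_le_of_form_bound:
  assumes "ns \<noteq> []"
    and "\<And>w. unit_family ns w \<Longrightarrow> \<bar>multilinear_form ns X w\<bar> \<le> s" and "0 \<le> s"
  shows "(frobenius_norm ns X)\<^sup>2 \<le> s\<^sup>2 * real (prod_list (butlast ns))"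
  using assms(1,2)
proof (induction ns arbitrary: X rule: list_nonempty_induct)
  case (single n)
  define r where "r = frobenius_norm [n] X"
  have r: "r\<^sup>2 = (\<Sum>i<n. (X [i])\<^sup>2)" "0 \<le> r"
    by (simp_all add: r_def frobenius_singleton frobenius_norm_nonneg)
  have "r \<le> s"
  proof (cases "r = 0")
    case False
    have "unit_vector n (\<lambda>i. X [i] / r)"
      using False by (simp add: unit_vector_iff power_divide flip: sum_divide_distrib r(1))
    moreover have "(\<Sum>i<n. X [i] / r * X [i]) = r"
      using False r(1) by (simp add: power2_eq_square field_simps flip: sum_divide_distrib)
    ultimately show ?thesis
      using single[of "\<lambda>_ i. X [i] / r"]
      by (simp add: unit_family_Cons unit_family_Nil multilinear_form_singleton)
  qed (use \<open>0 \<le> s\<close> in simp)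
  then show ?case using power_mono[OF _ r(2), of s 2] by (simp add: r_def)
next
  case (cons n ns)
  have "(frobenius_norm ns (\<lambda>is. X (i # is)))\<^sup>2 \<le> s\<^sup>2 * real (prod_list (butlast ns))" if "i < n" for i
    using cons.IH[OF form_bound_contract[OF cons.prems unit_std_vec[OF that]]]
    by (simp add: contract_std_vec[OF that])
  then have "(frobenius_norm (n # ns) X)\<^sup>2 \<le> (\<Sum>i<n. s\<^sup>2 * real (prod_list (butlast ns)))"
    unfolding frobenius_norm_sq_Cons by (intro sum_mono) simp
  then show ?case using cons.hyps by (simp add: mult_ac)
qed

text \<open>
  In the equality case every contraction with a unit vector must be an equality case again. Its
  squared norm is a quadratic form in the vector, given by the Gram matrix of the slices; this form
  is bounded by the previous lemma and its trace is extremal, hence it is constant on the sphere.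
\<close>

lemma orthogonal_of_form_bound:
  assumes "ns \<noteq> []"
    and "\<And>w. unit_family ns w \<Longrightarrow> \<bar>multilinear_form ns X w\<bar> \<le> 1"
    and "(frobenius_norm ns X)\<^sup>2 = real (prod_list (butlast ns))"
  shows "orthogonal_tensor ns X"
  using assms
proof (induction ns arbitrary: X rule: list_nonempty_induct)
  case (single n)
  then show ?case using frobenius_norm_nonneg[of "[n]" X] by (simp add: power2_eq_1_iff)
next
  case (cons n ns)
  let ?c = "real (prod_list (butlast ns))"
  let ?G = "\<lambda>i j. frobenius_inner ns (\<lambda>is. X (i # is)) (\<lambda>is. X (j # is))"
  have bound: "\<bar>multilinear_form ns (contract_first n X u) w\<bar> \<le> 1"
    if "unit_vector n u" "unit_family ns w" for u w
    using form_bound_contract[OF cons.prems(1) that] .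
  have "orthogonal_tensor ns (contract_first n X u)" if u: "unit_vector n u" for u
  proof (rule cons.IH)
    show "\<bar>multilinear_form ns (contract_first n X u) w\<bar> \<le> 1" if "unit_family ns w" for w
      using bound u that .
    show "(frobenius_norm ns (contract_first n X u))\<^sup>2 = ?c"
      unfolding frobenius_norm_contract
    proof (rule quadratic_form_constant[OF _ _ _ u])
      show "?G i j = ?G j i" for i j by (rule frobenius_inner_commute)
      show "(\<Sum>i<n. \<Sum>j<n. v i * v j * ?G i j) \<le> ?c" if "unit_vector n v" for v
        using frobenius_le_of_form_bound[OF cons.hyps bound[OF that]]
        by (simp add: frobenius_norm_contract)
      show "(\<Sum>i<n. ?G i i) = real n * ?c"
        using cons.prems(2) cons.hyps by (simp add: frobenius_norm_sq frobenius_inner_Cons)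
    qed
  qed
  then show ?case by (simp add: orthogonal_tensor_Cons cons.hyps)
qed

lemma orthogonal_frobenius:
  assumes "ns \<noteq> []" and "orthogonal_tensor ns X"
  shows "(frobenius_norm ns X)\<^sup>2 = real (prod_list (butlast ns))"
  using assms
proof (induction ns arbitrary: X rule: list_nonempty_induct)
  case (cons n ns)
  have "(frobenius_norm ns (\<lambda>is. X (i # is)))\<^sup>2 = real (prod_list (butlast ns))" if "i < n" for i
  proof -
    have "orthogonal_tensor ns (contract_first n X (std_vec i))"
      using cons.prems cons.hyps unit_std_vec[OF that] by (simp add: orthogonal_tensor_Cons)
    from cons.IH[OF this] show ?thesis by (simp add: contract_std_vec[OF that])
  qed
  then show ?case using cons.hyps by (simp add: frobenius_norm_sq_Cons)
qed simp

text \<open>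
  Contracting all but the last index leaves a unit vector, so this is the Cauchy-Schwarz inequality.
\<close>

lemma orthogonal_form_le:
  assumes "ns \<noteq> []" and "orthogonal_tensor ns X" and "unit_family ns w"
  shows "\<bar>multilinear_form ns X w\<bar> \<le> 1"
  using assms
proof (induction ns arbitrary: X w rule: list_nonempty_induct)
  case (single n)
  have "(\<Sum>i<n. (X [i])\<^sup>2) = 1" "(\<Sum>i<n. (w 0 i)\<^sup>2) = 1"
    using single by (simp_all add: unit_family_Cons unit_vector_iff flip: frobenius_singleton)
  then show ?case
    using L2_set_mult_ineq[of "w 0" "\<lambda>i. X [i]" "{..<n}"] sum_abs[of "\<lambda>i. w 0 i * X [i]" "{..<n}"]
    by (simp add: multilinear_form_singleton L2_set_def abs_mult)
next
  case (cons n ns)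
  then show ?case
    by (simp add: multilinear_form_Cons unit_family_Cons orthogonal_tensor_Cons)
qed

section \<open>Attainment of the extremal values\<close>

text \<open>
  Tychonoff's theorem. Vectors and tensors are functions on infinite index sets, whose topology is
  that of pointwise convergence; normalised objects, extended by zero, lie in this cube.
\<close>

lemma compact_cube: "compact {f::'a \<Rightarrow> real. \<forall>i. f i \<in> {-1..1}}"
proof -
  have "compactin (product_topology (\<lambda>i::'a. euclidean :: real topology) UNIV) (PiE UNIV (\<lambda>_. {-1..1}))"
    by (subst compactin_PiE) auto
  moreover have "PiE UNIV (\<lambda>_. {-1..1}) = {f::'a \<Rightarrow> real. \<forall>i. f i \<in> {-1..1}}"
    by auto
  ultimately show ?thesis
    by (simp add: euclidean_product_topology)
qed

lemma continuous_on_coordinate [continuous_intros]: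
  fixes x :: 'a
  shows "continuous_on A (\<lambda>f::'a \<Rightarrow> real. f x)"
  by (rule continuous_on_subset[OF continuous_on_product_coordinates]) simp

lemma multilinear_form_eq:
  "multilinear_form ns X u = (\<Sum>is\<in>multi_indices ns. X is * (\<Prod>k<length ns. u k (is ! k)))"
  unfolding multilinear_form_def frobenius_inner_def elementary_tensor_def
  by (rule sum.cong) simp_all

lemma multi_indices_nth: "is \<in> multi_indices ns \<Longrightarrow> k < length ns \<Longrightarrow> is ! k < ns ! k"
  by (simp add: multi_indices_def list_all2_conv_all_nth)

text \<open>
  A family of unit vectors is coded as one function on pairs \<open>(k, i)\<close>. The coded families in the
  cube form a compact set, on which the form is continuous; an arbitrary family enters it once
  its entries outside the format, which the form ignores, are replaced by zero.
\<close>

lemma spectral_norm_maximum: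
  assumes pos: "\<forall>n\<in>set ns. 0 < n"
  shows "\<exists>u. unit_family ns u \<and> spectral_norm ns X = \<bar>multilinear_form ns X u\<bar>"
    and "unit_family ns w \<Longrightarrow> \<bar>multilinear_form ns X w\<bar> \<le> spectral_norm ns X"
proof -
  let ?cube = "{f::nat \<times> nat \<Rightarrow> real. \<forall>i. f i \<in> {-1..1}}"
  let ?fam = "\<lambda>f k i. f (k, i) :: real"
  define U where "U = ?cube \<inter> {f. \<forall>k<length ns. (\<Sum>i<ns ! k. (f (k, i))\<^sup>2) = 1}"
  have U_unit: "unit_family ns (?fam f)" if "f \<in> U" for f
    using that by (simp add: U_def unit_family_def unit_vector_iff)
  have "closed {f::nat \<times> nat \<Rightarrow> real. \<forall>k<length ns. (\<Sum>i<ns ! k. (f (k, i))\<^sup>2) = 1}"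
    by (intro closed_Collect_all closed_Collect_imp closed_Collect_eq open_Collect_const continuous_intros)
  then have "compact U"
    unfolding U_def by (rule compact_Int_closed[OF compact_cube])
  moreover have "(\<lambda>(k, i). of_bool (i = 0)) \<in> U"
    using pos by (auto simp: U_def of_bool_def if_distrib[of "\<lambda>x. x\<^sup>2"] cong: if_cong)
  moreover have "continuous_on U (\<lambda>f. \<bar>multilinear_form ns X (?fam f)\<bar>)"
    unfolding multilinear_form_eq by (intro continuous_intros)
  ultimately obtain f where f: "f \<in> U"
      "\<And>g. g \<in> U \<Longrightarrow> \<bar>multilinear_form ns X (?fam g)\<bar> \<le> \<bar>multilinear_form ns X (?fam f)\<bar>"
    using continuous_attains_sup[of U "\<lambda>f. \<bar>multilinear_form ns X (?fam f)\<bar>"] by blast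
  have le: "\<bar>multilinear_form ns X u\<bar> \<le> \<bar>multilinear_form ns X (?fam f)\<bar>" if u: "unit_family ns u" for u
  proof -
    define g where "g = (\<lambda>(k, i). if k < length ns \<and> i < ns ! k then u k i else 0)"
    have sq: "(\<Sum>i<ns ! k. (u k i)\<^sup>2) = 1" if "k < length ns" for k
      using u that by (simp add: unit_family_def unit_vector_iff)
    have "-1 \<le> u k i \<and> u k i \<le> 1" if "k < length ns" "i < ns ! k" for k i
    proof -
      have "(u k i)\<^sup>2 \<le> (\<Sum>i<ns ! k. (u k i)\<^sup>2)"
        using that by (intro member_le_sum) auto
      then have "\<bar>u k i\<bar> \<le> 1" using sq[OF that(1)] by (simp only: abs_square_le_1)
      then show ?thesis by linarith
    qed
    then have "g \<in> U"
      using sq by (auto simp: U_def g_def)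
    moreover have "multilinear_form ns X (?fam g) = multilinear_form ns X u"
      unfolding multilinear_form_eq
      by (intro sum.cong refl arg_cong2[of _ _ _ _ "(*)"] prod.cong) (simp_all add: g_def multi_indices_nth)
    ultimately show ?thesis using f(2) by force
  qed
  have spec: "spectral_norm ns X = \<bar>multilinear_form ns X (?fam f)\<bar>"
    unfolding spectral_norm_def unit_family_def[symmetric] multilinear_form_def[symmetric]
    by (rule Greatest_equality) (use f(1) U_unit le in auto)
  then show "\<exists>u. unit_family ns u \<and> spectral_norm ns X = \<bar>multilinear_form ns X u\<bar>"
    using f(1) U_unit by blast
  show "unit_family ns w \<Longrightarrow> \<bar>multilinear_form ns X w\<bar> \<le> spectral_norm ns X"
    using le spec by simp
qed

lemma spectral_norm_scale:
  assumes pos: "\<forall>n\<in>set ns. 0 < n"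
  shows "spectral_norm ns (\<lambda>is. c * X is) = \<bar>c\<bar> * spectral_norm ns X"
proof -
  have form: "\<bar>multilinear_form ns (\<lambda>is. c * X is) u\<bar> = \<bar>c\<bar> * \<bar>multilinear_form ns X u\<bar>" for u
  proof -
    have "multilinear_form ns (\<lambda>is. c * X is) u = c * multilinear_form ns X u"
      unfolding multilinear_form_eq sum_distrib_left by (simp only: mult.assoc)
    then show ?thesis by (simp add: abs_mult)
  qed
  show ?thesis
  proof (rule antisym)
    obtain u where "unit_family ns u"
        "spectral_norm ns (\<lambda>is. c * X is) = \<bar>multilinear_form ns (\<lambda>is. c * X is) u\<bar>"
      using spectral_norm_maximum(1)[OF pos] by blast
    then show "spectral_norm ns (\<lambda>is. c * X is) \<le> \<bar>c\<bar> * spectral_norm ns X"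
      using spectral_norm_maximum(2)[OF pos] by (simp add: form mult_left_mono)
    obtain u where "unit_family ns u" "spectral_norm ns X = \<bar>multilinear_form ns X u\<bar>"
      using spectral_norm_maximum(1)[OF pos] by blast
    then show "\<bar>c\<bar> * spectral_norm ns X \<le> spectral_norm ns (\<lambda>is. c * X is)"
      using spectral_norm_maximum(2)[OF pos, of u "\<lambda>is. c * X is"] by (simp add: form)
  qed
qed

lemma frobenius_norm_scale:
  "frobenius_norm ns (\<lambda>is. c * X is) = \<bar>c\<bar> * frobenius_norm ns X"
  unfolding frobenius_norm_def by (simp add: L2_set_def power_mult_distrib real_sqrt_mult flip: sum_distrib_left)

lemma frobenius_norm_pos:
  assumes "X \<in> tensors ns" "X \<noteq> (\<lambda>_. 0)"
  shows "0 < frobenius_norm ns X"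
proof -
  obtain "is" where "X is \<noteq> 0" using assms(2) by auto
  moreover from this have "is \<in> multi_indices ns" using assms(1) by (auto simp: tensors_def)
  ultimately have "frobenius_norm ns X \<noteq> 0"
    by (auto simp: frobenius_norm_def L2_set_eq_0_iff finite_multi_indices)
  then show ?thesis using frobenius_norm_nonneg[of ns X] by simp
qed

text \<open>
  The sublevel sets of the spectral norm are closed because they are intersections of conditions
  \<open>\<bar>multilinear_form ns X u\<bar> \<le> s\<close>, each continuous in \<open>X\<close>. The sublevel sets at the values taken on
  the compact Frobenius sphere have the finite intersection property, and any common point is a minimum.
\<close>

lemma spectral_norm_minimum:
  assumes pos: "\<forall>n\<in>set ns. 0 < n"
  obtains X where "X \<in> tensors ns" "frobenius_norm ns X = 1"
    "\<And>Y. Y \<in> tensors ns \<Longrightarrow> frobenius_norm ns Y = 1 \<Longrightarrow> spectral_norm ns X \<le> spectral_norm ns Y"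
proof -
  define K where "K = {X \<in> tensors ns. frobenius_norm ns X = 1}"
  define C where "C s = {X. \<forall>u. unit_family ns u \<longrightarrow> \<bar>multilinear_form ns X u\<bar> \<le> s}" for s
  let ?cube = "{f::nat list \<Rightarrow> real. \<forall>i. f i \<in> {-1..1}}"
  have "X is \<in> {-1..1}" if X: "X \<in> K" for X "is"
  proof (cases "is \<in> multi_indices ns")
    case True
    then have "\<bar>X is\<bar> \<le> frobenius_norm ns X"
      using member_le_L2_set[OF finite_multi_indices True, of "\<lambda>is. \<bar>X is\<bar>"]
      by (simp add: frobenius_norm_def L2_set_def)
    then show ?thesis using X by (auto simp: K_def)
  next
    case False
    then show ?thesis using X by (simp add: K_def tensors_def)
  qed
  then have K_eq: "K = ?cube \<inter> {X. (\<forall>is. is \<notin> multi_indices ns \<longrightarrow> X is = 0) \<and> (\<Sum>is\<in>multi_indices ns. (X is)\<^sup>2) = 1}"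
    by (auto simp: K_def tensors_def frobenius_norm_def L2_set_def)
  have closed: "closed {X :: nat list \<Rightarrow> real. (\<forall>is. is \<notin> multi_indices ns \<longrightarrow> X is = 0) \<and> (\<Sum>is\<in>multi_indices ns. (X is)\<^sup>2) = 1}"
    by (intro closed_Collect_conj closed_Collect_all closed_Collect_imp closed_Collect_eq open_Collect_const
        continuous_intros)
  have "compact K"
    unfolding K_eq by (rule compact_Int_closed[OF compact_cube closed])
  have "closed (C s)" for s
    unfolding C_def multilinear_form_eq
    by (intro closed_Collect_all closed_Collect_imp closed_Collect_le open_Collect_const continuous_intros)
  have spec_C: "X \<in> C s \<longleftrightarrow> spectral_norm ns X \<le> s" for X s
    using spectral_norm_maximum[OF pos, where X = X] unfolding C_def by force
  have "K \<noteq> {}"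
  proof -
    let ?z = "replicate (length ns) (0::nat)"
    have z: "?z \<in> multi_indices ns"
      using pos by (simp add: multi_indices_def list_all2_conv_all_nth)
    have "(\<lambda>is. of_bool (is = ?z)) \<in> K"
      using z by (auto simp: K_def tensors_def frobenius_norm_def L2_set_def finite_multi_indices
          of_bool_def if_distrib[of "\<lambda>x. x\<^sup>2"] cong: if_cong)
    then show ?thesis by blast
  qed
  have "K \<inter> (\<Inter>Y\<in>K. C (spectral_norm ns Y)) \<noteq> {}"
  proof (rule compact_imp_fip_image[OF \<open>compact K\<close>])
    fix F assume F: "finite F" "F \<subseteq> K"
    show "K \<inter> (\<Inter>Y\<in>F. C (spectral_norm ns Y)) \<noteq> {}"
    proof (cases "F = {}")
      case False
      then obtain X where "X \<in> F" "\<And>Y. Y \<in> F \<Longrightarrow> spectral_norm ns X \<le> spectral_norm ns Y"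
        using F(1) by (metis arg_min_least arg_min_if_finite(1))
      then show ?thesis using F by (auto simp: spec_C)
    qed (use \<open>K \<noteq> {}\<close> in simp)
  qed (use \<open>\<And>s. closed (C s)\<close> in blast)
  then obtain X where "X \<in> K" "\<And>Y. Y \<in> K \<Longrightarrow> spectral_norm ns X \<le> spectral_norm ns Y"
    using spec_C by blast
  then show ?thesis
    using that[of X] by (simp add: K_def)
qed

lemma App_minimum:
  assumes pos: "\<forall>n\<in>set ns. 0 < n"
  shows "\<exists>X\<in>tensors ns. frobenius_norm ns X = 1 \<and> App ns = spectral_norm ns X"
    and "Y \<in> tensors ns \<Longrightarrow> Y \<noteq> (\<lambda>_. 0) \<Longrightarrow> App ns \<le> spectral_norm ns Y / frobenius_norm ns Y"
proof -
  obtain X where X: "X \<in> tensors ns" "frobenius_norm ns X = 1"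
    and min: "\<And>Y. Y \<in> tensors ns \<Longrightarrow> frobenius_norm ns Y = 1 \<Longrightarrow> spectral_norm ns X \<le> spectral_norm ns Y"
    using spectral_norm_minimum[OF pos] by blast
  have le: "spectral_norm ns X \<le> spectral_norm ns Y / frobenius_norm ns Y"
    if Y: "Y \<in> tensors ns" "Y \<noteq> (\<lambda>_. 0)" for Y
  proof -
    let ?c = "1 / frobenius_norm ns Y"
    have "0 < frobenius_norm ns Y" by (rule frobenius_norm_pos[OF Y])
    moreover have "frobenius_norm ns (\<lambda>is. ?c * Y is) = 1"
      unfolding frobenius_norm_scale using calculation by simp
    moreover have "spectral_norm ns (\<lambda>is. ?c * Y is) = spectral_norm ns Y / frobenius_norm ns Y"
      unfolding spectral_norm_scale[OF pos] using calculation by simp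
    ultimately show ?thesis
      using min[of "\<lambda>is. ?c * Y is"] Y(1) by (simp add: tensors_def)
  qed
  have "X \<noteq> (\<lambda>_. 0)"
    using X(2) by (auto simp: frobenius_norm_def L2_set_def)
  then have App: "App ns = spectral_norm ns X"
    unfolding App_def using X le by (intro Least_equality) (auto intro!: bexI[of _ X])
  then show "\<exists>X\<in>tensors ns. frobenius_norm ns X = 1 \<and> App ns = spectral_norm ns X"
    using X by blast
  show "Y \<in> tensors ns \<Longrightarrow> Y \<noteq> (\<lambda>_. 0) \<Longrightarrow> App ns \<le> spectral_norm ns Y / frobenius_norm ns Y"
    using le App by simp
qed

lemma prod_list_butlast_pos:
  "\<forall>n\<in>set ns. 0 < n \<Longrightarrow> 0 < prod_list (butlast ns)" for ns :: "nat list"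
  by (induction ns) auto

section \<open>The value of App and orthogonal tensors\<close>

text \<open>
  A minimiser of Frobenius norm one satisfies \<open>1 \<le> (App ns)\<^sup>2 * p\<close>, where \<open>p\<close> is the product of all
  dimensions but the last. In the case of equality the minimiser times \<open>sqrt p\<close> has a form bounded by
  one and the extremal Frobenius norm, so it is orthogonal; conversely an orthogonal tensor has
  Frobenius norm \<open>sqrt p\<close> and spectral norm at most one.
\<close>

theorem App_bound:
  assumes ne: "ns \<noteq> []" and pos: "\<forall>n\<in>set ns. 0 < n"
  shows "1 / sqrt (real (prod_list (butlast ns))) \<le> App ns"
    and "App ns = 1 / sqrt (real (prod_list (butlast ns))) \<longleftrightarrow>
      (\<exists>X\<in>tensors ns. orthogonal_tensor ns X)"
proof -
  define p where "p = real (prod_list (butlast ns))"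
  have p: "p > 0" using prod_list_butlast_pos[OF pos] by (simp add: p_def)
  obtain X where X: "X \<in> tensors ns" "frobenius_norm ns X = 1" "App ns = spectral_norm ns X"
    using App_minimum(1)[OF pos] by blast
  have nonneg: "0 \<le> spectral_norm ns X"
    using spectral_norm_maximum(1)[OF pos, of X] by force
  have "1 \<le> (spectral_norm ns X)\<^sup>2 * p"
    using frobenius_le_of_form_bound[OF ne spectral_norm_maximum(2)[OF pos] nonneg] X(2)
    by (simp add: p_def)
  then have "sqrt 1 \<le> sqrt ((spectral_norm ns X)\<^sup>2 * p)"
    by (simp only: real_sqrt_le_iff)
  then have "1 \<le> spectral_norm ns X * sqrt p"
    using nonneg by (simp add: real_sqrt_mult)
  then show ge: "1 / sqrt (real (prod_list (butlast ns))) \<le> App ns"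
    using p unfolding X(3) p_def[symmetric] by (simp add: divide_le_eq)
  show "App ns = 1 / sqrt (real (prod_list (butlast ns))) \<longleftrightarrow>
      (\<exists>X\<in>tensors ns. orthogonal_tensor ns X)"
    unfolding p_def[symmetric]
  proof
    assume "App ns = 1 / sqrt p"
    then have spec: "spectral_norm ns X = 1 / sqrt p" using X by simp
    let ?Y = "\<lambda>is. sqrt p * X is"
    have "orthogonal_tensor ns ?Y"
    proof (rule orthogonal_of_form_bound[OF ne])
      show "\<bar>multilinear_form ns ?Y w\<bar> \<le> 1" if "unit_family ns w" for w
        using spectral_norm_maximum(2)[OF pos that, of ?Y] spec p
        by (simp add: spectral_norm_scale[OF pos])
      show "(frobenius_norm ns ?Y)\<^sup>2 = real (prod_list (butlast ns))"
        using p X(2) by (simp add: frobenius_norm_scale p_def[symmetric])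
    qed
    then show "\<exists>X\<in>tensors ns. orthogonal_tensor ns X"
      using X(1) by (intro bexI[of _ ?Y]) (auto simp: tensors_def)
  next
    assume "\<exists>X\<in>tensors ns. orthogonal_tensor ns X"
    then obtain Y where Y: "Y \<in> tensors ns" "orthogonal_tensor ns Y" by blast
    have frob: "frobenius_norm ns Y = sqrt p"
      using orthogonal_frobenius[OF ne Y(2)] frobenius_norm_nonneg[of ns Y]
      by (simp add: p_def real_sqrt_unique)
    then have "Y \<noteq> (\<lambda>_. 0)"
      using p by (auto simp: frobenius_norm_def L2_set_def)
    moreover have "spectral_norm ns Y \<le> 1"
      using spectral_norm_maximum(1)[OF pos, of Y] orthogonal_form_le[OF ne Y(2)] by auto
    ultimately have "App ns \<le> 1 / sqrt p"
      using App_minimum(2)[OF pos Y(1)] frob p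
      by (metis (no_types, lifting) divide_right_mono order_trans real_sqrt_ge_zero less_imp_le)
    then show "App ns = 1 / sqrt p"
      using ge by (simp add: p_def)
  qed
qed

section \<open>Dimensions admitting orthogonal tensors\<close>

text \<open>
  Finitely supported functions form one inner product space that contains a copy of the Euclidean
  space of every dimension \<open>n\<close>, with \<open>n\<close> a number rather than a type.
\<close>

instantiation poly_mapping :: (type, real_vector) real_vector
begin

lift_definition scaleR_poly_mapping :: "real \<Rightarrow> ('a \<Rightarrow>\<^sub>0 'b) \<Rightarrow> 'a \<Rightarrow>\<^sub>0 'b"
  is "\<lambda>r f k. r *\<^sub>R f k"
  by (rule finite_subset[rotated]) auto

instance
  by standard (transfer, simp add: fun_eq_iff algebra_simps)+

end

instantiation poly_mapping :: (type, real_inner) real_inner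
begin

definition inner_poly_mapping :: "('a \<Rightarrow>\<^sub>0 'b) \<Rightarrow> ('a \<Rightarrow>\<^sub>0 'b) \<Rightarrow> real" where
  "inner_poly_mapping x y = (\<Sum>k\<in>Poly_Mapping.keys x \<inter> Poly_Mapping.keys y. Poly_Mapping.lookup x k \<bullet> Poly_Mapping.lookup y k)"

definition norm_poly_mapping :: "('a \<Rightarrow>\<^sub>0 'b) \<Rightarrow> real" where
  "norm_poly_mapping x = sqrt (x \<bullet> x)"

definition sgn_poly_mapping :: "('a \<Rightarrow>\<^sub>0 'b) \<Rightarrow> ('a \<Rightarrow>\<^sub>0 'b)" where
  "sgn_poly_mapping x = x /\<^sub>R norm x"

definition dist_poly_mapping :: "('a \<Rightarrow>\<^sub>0 'b) \<Rightarrow> ('a \<Rightarrow>\<^sub>0 'b) \<Rightarrow> real" where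
  "dist_poly_mapping x y = norm (x - y)"

definition uniformity_poly_mapping :: "(('a \<Rightarrow>\<^sub>0 'b) \<times> ('a \<Rightarrow>\<^sub>0 'b)) filter" where
  "uniformity_poly_mapping = (INF e\<in>{0<..}. principal {(x, y). dist x y < e})"

definition open_poly_mapping :: "('a \<Rightarrow>\<^sub>0 'b) set \<Rightarrow> bool" where
  "open_poly_mapping U \<longleftrightarrow> (\<forall>x\<in>U. \<forall>\<^sub>F (x', y) in uniformity. x' = x \<longrightarrow> y \<in> U)"

lemma inner_poly_mapping_superset:
  fixes x y :: "'a \<Rightarrow>\<^sub>0 'b"
  assumes "finite K" "Poly_Mapping.keys x \<subseteq> K"
  shows "x \<bullet> y = (\<Sum>k\<in>K. Poly_Mapping.lookup x k \<bullet> Poly_Mapping.lookup y k)"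
  unfolding inner_poly_mapping_def
  using assms by (intro sum.mono_neutral_left) (auto simp: in_keys_iff)

instance
proof
  fix x y z :: "'a \<Rightarrow>\<^sub>0 'b" and r :: real
  let ?K = "Poly_Mapping.keys x \<union> Poly_Mapping.keys y \<union> Poly_Mapping.keys (x + y) \<union> Poly_Mapping.keys (r *\<^sub>R x)"
  show "x \<bullet> y = y \<bullet> x"
    by (simp add: inner_poly_mapping_def Int_commute inner_commute)
  show "(x + y) \<bullet> z = x \<bullet> z + y \<bullet> z"
    by (subst (1 2 3) inner_poly_mapping_superset[of ?K])
       (auto simp: lookup_add inner_add_left sum.distrib)
  show "(r *\<^sub>R x) \<bullet> y = r * (x \<bullet> y)"
    by (subst (1 2) inner_poly_mapping_superset[of ?K])
       (auto simp: scaleR_poly_mapping.rep_eq sum_distrib_left)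
  show "0 \<le> x \<bullet> x"
    by (simp add: inner_poly_mapping_def sum_nonneg)
  show "x \<bullet> x = 0 \<longleftrightarrow> x = 0"
    by (simp add: inner_poly_mapping_def sum_nonneg_eq_0_iff in_keys_iff)
       (metis keys_eq_empty ex_in_conv in_keys_iff)
qed (rule norm_poly_mapping_def sgn_poly_mapping_def dist_poly_mapping_def
     uniformity_poly_mapping_def open_poly_mapping_def)+

end

lemma lookup_scaleR:
  fixes x :: "'a \<Rightarrow>\<^sub>0 'b::real_vector"
  shows "Poly_Mapping.lookup (r *\<^sub>R x) k = r *\<^sub>R Poly_Mapping.lookup x k"
  by (simp add: scaleR_poly_mapping.rep_eq)

lemma orthonormal_basis_singles:
  "orthonormal_basis ((\<lambda>i. Poly_Mapping.single i 1) ` {..<n}) {x :: nat \<Rightarrow>\<^sub>0 real. Poly_Mapping.keys x \<subseteq> {..<n}}"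
    (is "orthonormal_basis ?B ?S")
proof -
  have inner: "Poly_Mapping.single i 1 \<bullet> Poly_Mapping.single j (1::real) = of_bool (i = j)" for i j :: nat
    by (subst inner_poly_mapping_superset[of "{i}"]) (auto simp: lookup_single when_def)
  have "subspace ?S"
    unfolding subspace_def by (auto simp: in_keys_iff lookup_add lookup_scaleR subset_iff)
      (metis add.right_neutral)
  then have "span ?B \<subseteq> ?S"
    by (intro span_minimal) auto
  moreover have "x \<in> span ?B" if "Poly_Mapping.keys x \<subseteq> {..<n}" for x :: "nat \<Rightarrow>\<^sub>0 real"
  proof -
    have "x = (\<Sum>i<n. Poly_Mapping.lookup x i *\<^sub>R Poly_Mapping.single i 1)"
    proof (rule poly_mapping_eqI)
      fix k
      have "(\<Sum>i<n. Poly_Mapping.lookup x i * (1 when i = k)) = (\<Sum>i<n. if i = k then Poly_Mapping.lookup x k else 0)"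
        by (rule sum.cong) (auto simp: when_def)
      also have "\<dots> = Poly_Mapping.lookup x k"
        using that by (auto simp: in_keys_iff)
      finally show "Poly_Mapping.lookup x k = Poly_Mapping.lookup (\<Sum>i<n. Poly_Mapping.lookup x i *\<^sub>R Poly_Mapping.single i 1) k"
        by (simp add: lookup_sum lookup_scaleR lookup_single)
    qed
    also have "\<dots> \<in> span ?B"
      by (intro span_sum span_scale span_base) auto
    finally show ?thesis .
  qed
  ultimately have "span ?B = ?S" by blast
  then show ?thesis
    by (auto simp: orthonormal_basis_def pairwise_def orthogonal_def inner norm_eq_1)
qed

lemma card_singles: "card ((\<lambda>i. Poly_Mapping.single i (1::real)) ` {..<n::nat}) = n"
proof -
  have "inj_on (\<lambda>i. Poly_Mapping.single i (1::real)) {..<n}"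
    by (rule inj_onI) (metis lookup_single_eq lookup_single_not_eq zero_neq_one)
  then show ?thesis by (simp add: card_image)
qed

text \<open>
  An orthogonal tensor of order three is the array of structure constants of a bilinear product
  under which unit vectors have unit products.
\<close>

theorem orthogonal_order_three:
  assumes X: "orthogonal_tensor [n, n, n] X" and "n \<ge> 1"
  shows "n \<in> {1, 2, 4, 8}"
proof -
  define S where "S = {x :: nat \<Rightarrow>\<^sub>0 real. Poly_Mapping.keys x \<subseteq> {..<n}}"
  define B where "B = (\<lambda>i. Poly_Mapping.single i (1::real)) ` {..<n}"
  define b where "b u v k = (\<Sum>i<n. \<Sum>j<n. u i * v j * X [i, j, k])" for u v k
  define mult where "mult x y = (\<Sum>k<n. Poly_Mapping.single k (b (Poly_Mapping.lookup x) (Poly_Mapping.lookup y) k))"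
    for x y :: "nat \<Rightarrow>\<^sub>0 real"
  have B: "orthonormal_basis B S" "card B = n"
    unfolding B_def S_def by (rule orthonormal_basis_singles card_singles)+
  have lookup_mult: "Poly_Mapping.lookup (mult x y) k = (if k < n then b (Poly_Mapping.lookup x) (Poly_Mapping.lookup y) k else 0)" for x y k
  proof -
    have "Poly_Mapping.lookup (mult x y) k = (\<Sum>l<n. if l = k then b (Poly_Mapping.lookup x) (Poly_Mapping.lookup y) k else 0)"
      unfolding mult_def lookup_sum by (rule sum.cong) (auto simp: lookup_single when_def)
    then show ?thesis by simp
  qed
  have norm_S: "(norm x)\<^sup>2 = (\<Sum>i<n. (Poly_Mapping.lookup x i)\<^sup>2)" if "x \<in> S" for x
    using that inner_poly_mapping_superset[of "{..<n}" x x]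
    by (simp add: S_def power2_norm_eq_inner) (simp add: power2_eq_square)
  have S_mult: "mult x y \<in> S" for x y
    by (auto simp: S_def in_keys_iff lookup_mult split: if_splits)
  have scale: "mult (r *\<^sub>R x) (s *\<^sub>R y) = (r * s) *\<^sub>R mult x y" for r s x y
    by (rule poly_mapping_eqI)
       (simp add: lookup_mult lookup_scaleR b_def sum_distrib_left mult_ac)
  have bil: "bilinear mult"
    unfolding bilinear_def
    by (intro conjI allI linearI poly_mapping_eqI)
       (simp_all add: lookup_mult lookup_scaleR lookup_add b_def sum_distrib_left sum.distrib algebra_simps)
  have norm_unit: "norm (mult x y) = 1" if "x \<in> S" "y \<in> S" "norm x = 1" "norm y = 1" for x y
  proof -
    have "unit_vector n (Poly_Mapping.lookup x)" "unit_vector n (Poly_Mapping.lookup y)"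
      using norm_S[of x] norm_S[of y] that by (simp_all add: unit_vector_iff)
    then have "frobenius_norm [n] (contract_first n (contract_first n X (Poly_Mapping.lookup x)) (Poly_Mapping.lookup y)) = 1"
      using X by simp
    moreover have "contract_first n (contract_first n X (Poly_Mapping.lookup x)) (Poly_Mapping.lookup y) [k] =
        b (Poly_Mapping.lookup x) (Poly_Mapping.lookup y) k" for k
      unfolding contract_first_def b_def sum_distrib_left
      by (subst sum.swap) (simp add: mult_ac)
    ultimately have "(\<Sum>k<n. (b (Poly_Mapping.lookup x) (Poly_Mapping.lookup y) k)\<^sup>2) = 1"
      using frobenius_singleton[of n "contract_first n (contract_first n X (Poly_Mapping.lookup x)) (Poly_Mapping.lookup y)"] by simp
    then have "(norm (mult x y))\<^sup>2 = 1"
      by (simp add: norm_S[OF S_mult] lookup_mult)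
    then show ?thesis
      by (metis abs_norm_cancel power2_eq_1_iff abs_1 abs_minus_cancel)
  qed
  have norm_mult: "norm (mult x y) = norm x * norm y" if "x \<in> S" "y \<in> S" for x y
  proof (cases "x = 0 \<or> y = 0")
    case True
    then show ?thesis
      using bilinear_lzero[OF bil] bilinear_rzero[OF bil] by auto
  next
    case False
    have "subspace S"
      using B(1) subspace_span by (auto simp: orthonormal_basis_def)
    then have "norm (mult ((1 / norm x) *\<^sub>R x) ((1 / norm y) *\<^sub>R y)) = 1"
      using that False by (intro norm_unit) (simp_all add: subspace_scale)
    then show ?thesis
      unfolding scale using False by (simp add: field_simps)
  qed
  have "S \<noteq> {0}"
  proof -
    have "Poly_Mapping.single 0 (1::real) \<in> S" using \<open>n \<ge> 1\<close> by (auto simp: S_def)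
    moreover have "Poly_Mapping.single 0 (1::real) \<noteq> (0 :: nat \<Rightarrow>\<^sub>0 real)"
      by (metis lookup_single_eq lookup_zero zero_neq_one)
    ultimately show ?thesis by blast
  qed
  then have "card B \<in> {1, 2, 4, 8}"
    using hurwitz[OF B(1) _ bil S_mult norm_mult] by blast
  then show ?thesis by (simp add: B(2))
qed

text \<open>
  Contractions of orthogonal tensors with unit vectors are orthogonal, which reduces every order to three.
\<close>

lemma orthogonal_tensor_dimension:
  assumes "3 \<le> d" "n \<ge> 1" "orthogonal_tensor (replicate d n) X"
  shows "n \<in> {1, 2, 4, 8}"
proof -
  have "\<exists>Y. orthogonal_tensor (replicate 3 n) Y"
    using assms(1,3)
  proof (induction d arbitrary: X rule: dec_induct)
    case (step d)
    then have "orthogonal_tensor (replicate d n) (contract_first n X (std_vec 0))"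
      using unit_std_vec[of 0 n] \<open>n \<ge> 1\<close> by (simp add: orthogonal_tensor_Cons)
    then show ?case using step.IH by blast
  qed blast
  then show ?thesis
    using orthogonal_order_three \<open>n \<ge> 1\<close> by (auto simp: eval_nat_numeral)
qed

section \<open>Construction of orthogonal tensors\<close>

unbundle bit_operations_syntax

text \<open>
  The octonion basis \<open>e\<^sub>0, \<dots>, e\<^sub>7\<close> obtained by doubling three times satisfies \<open>e\<^sub>i e\<^sub>j = \<plusminus> e\<^sub>k\<close> with
  \<open>k = i XOR j\<close>, since \<open>e\<^bsub>i + h\<^esub> = e\<^sub>i e\<^sub>h\<close> when \<open>h\<close> is 1, 2 or 4 and \<open>i < h\<close>; the table lists the signs. Its leading
  blocks of size 1, 2 and 4 belong to the real numbers, complex numbers and quaternions.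
\<close>

definition cayley_sign :: "nat \<Rightarrow> nat \<Rightarrow> real" where
  "cayley_sign i j =
    ([[1, 1, 1, 1, 1, 1, 1, 1],
     [1, -1, 1, -1, 1, -1, -1, 1],
     [1, -1, -1, 1, 1, 1, -1, -1],
     [1, 1, -1, -1, 1, -1, 1, -1],
     [1, -1, -1, -1, -1, 1, 1, 1],
     [1, 1, -1, 1, -1, -1, -1, 1],
     [1, 1, 1, -1, -1, 1, -1, -1],
     [1, -1, 1, 1, -1, -1, 1, -1]]) ! i ! j"

definition cayley_constant :: "nat \<Rightarrow> nat \<Rightarrow> nat \<Rightarrow> real" where
  "cayley_constant i j k = (if k = i XOR j then cayley_sign i j else 0)"

lemma sum_lessThan_small:
  fixes f :: "nat \<Rightarrow> real"
  shows "(\<Sum>i<2. f i) = f 0 + f 1"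
    and "(\<Sum>i<4. f i) = f 0 + f 1 + f 2 + f 3"
    and "(\<Sum>i<8. f i) = f 0 + f 1 + f 2 + f 3 + f 4 + f 5 + f 6 + f 7"
  by (simp_all add: eval_nat_numeral)

lemma two_square_identity: "(\<Sum>k<2. (\<Sum>i<2. \<Sum>j<2. u i * v j * cayley_constant i j k)\<^sup>2) =
    (\<Sum>i<2. (u i)\<^sup>2) * (\<Sum>j<2. (v j)\<^sup>2)"
  unfolding sum_lessThan_small
  by (simp add: cayley_constant_def cayley_sign_def) algebra

lemma four_square_identity: "(\<Sum>k<4. (\<Sum>i<4. \<Sum>j<4. u i * v j * cayley_constant i j k)\<^sup>2) =
    (\<Sum>i<4. (u i)\<^sup>2) * (\<Sum>j<4. (v j)\<^sup>2)"
  unfolding sum_lessThan_small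
  by (simp add: cayley_constant_def cayley_sign_def) algebra

lemma eight_square_identity: "(\<Sum>k<8. (\<Sum>i<8. \<Sum>j<8. u i * v j * cayley_constant i j k)\<^sup>2) =
    (\<Sum>i<8. (u i)\<^sup>2) * (\<Sum>j<8. (v j)\<^sup>2)"
  unfolding sum_lessThan_small
  by (simp add: cayley_constant_def cayley_sign_def) algebra


lemma orthogonal_tensor_cong:
  assumes "\<And>is. is \<in> multi_indices ns \<Longrightarrow> X is = Y is"
  shows "orthogonal_tensor ns X \<longleftrightarrow> orthogonal_tensor ns Y"
  using assms
proof (induction ns X arbitrary: Y rule: orthogonal_tensor.induct)
  case (3 n m ns X)
  have "contract_first n X u is = contract_first n Y u is" if "is \<in> multi_indices (m # ns)" for u "is"
    using 3(2) that by (simp add: contract_first_def)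
  then show ?case using 3(1) by simp
qed (simp_all add: frobenius_norm_def cong: L2_set_cong)

text \<open>
  As a multilinear form this is \<open>Y (u * v, w\<^sub>3, w\<^sub>4, \<dots>)\<close>, where \<open>*\<close> is the product with structure
  constants \<open>t\<close>.
\<close>

definition compose_tensor ::
    "nat \<Rightarrow> (nat \<Rightarrow> nat \<Rightarrow> nat \<Rightarrow> real) \<Rightarrow> (nat list \<Rightarrow> real) \<Rightarrow> nat list \<Rightarrow> real" where
  "compose_tensor n t Y = (\<lambda>is. \<Sum>k<n. t (is ! 0) (is ! 1) k * Y (k # drop 2 is))"

text \<open>
  Contracting with unit vectors \<open>u\<close> and \<open>v\<close> is the same as contracting \<open>Y\<close> with their product, which is
  again a unit vector.
\<close>

lemma orthogonal_compose_tensor: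
  assumes comp: "\<And>u v. (\<Sum>k<n. (\<Sum>i<n. \<Sum>j<n. u i * v j * t i j k)\<^sup>2) =
      (\<Sum>i<n. (u i)\<^sup>2) * (\<Sum>j<n. (v j)\<^sup>2)"
    and "ns \<noteq> []" and Y: "orthogonal_tensor (n # ns) Y"
  shows "orthogonal_tensor (n # n # ns) (compose_tensor n t Y)"
proof -
  have "orthogonal_tensor ns (contract_first n (contract_first n (compose_tensor n t Y) u) v)"
    if u: "unit_vector n u" and v: "unit_vector n v" for u v
  proof -
    define w where "w k = (\<Sum>i<n. \<Sum>j<n. u i * v j * t i j k)" for k
    have "unit_vector n w"
      using comp[of u v] u v by (simp add: unit_vector_iff w_def)
    moreover have "contract_first n (contract_first n (compose_tensor n t Y) u) v = contract_first n Y w"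
    proof
      fix "is"
      have "contract_first n (contract_first n (compose_tensor n t Y) u) v is =
          (\<Sum>j<n. \<Sum>i<n. \<Sum>k<n. u i * v j * t i j k * Y (k # is))"
        by (simp add: contract_first_def compose_tensor_def sum_distrib_left mult_ac)
      also have "\<dots> = (\<Sum>i<n. \<Sum>j<n. \<Sum>k<n. u i * v j * t i j k * Y (k # is))"
        by (rule sum.swap)
      also have "\<dots> = (\<Sum>i<n. \<Sum>k<n. \<Sum>j<n. u i * v j * t i j k * Y (k # is))"
        by (intro sum.cong refl sum.swap)
      also have "\<dots> = (\<Sum>k<n. \<Sum>i<n. \<Sum>j<n. u i * v j * t i j k * Y (k # is))"
        by (rule sum.swap)
      also have "\<dots> = contract_first n Y w is"
        by (simp add: contract_first_def w_def sum_distrib_right)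
      finally show "contract_first n (contract_first n (compose_tensor n t Y) u) v is = contract_first n Y w is" .
    qed
    ultimately show ?thesis
      using Y \<open>ns \<noteq> []\<close> by (simp add: orthogonal_tensor_Cons)
  qed
  then show ?thesis using \<open>ns \<noteq> []\<close> by (simp add: orthogonal_tensor_Cons)
qed

lemma orthogonal_identity_tensor: "orthogonal_tensor [n, n] (\<lambda>is. of_bool (is ! 0 = is ! 1))"
proof -
  have "frobenius_norm [n] (contract_first n (\<lambda>is. of_bool (is ! 0 = is ! 1)) u) = 1"
    if "unit_vector n u" for u
  proof -
    have "contract_first n (\<lambda>is. of_bool (is ! 0 = is ! 1)) u [k] = u k" if "k < n" for k
    proof -
      have "(\<Sum>i<n. u i * of_bool (i = k)) = (\<Sum>i<n. if i = k then u k else 0)"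
        by (rule sum.cong) auto
      then show ?thesis using that by (simp add: contract_first_def)
    qed
    then have "(frobenius_norm [n] (contract_first n (\<lambda>is. of_bool (is ! 0 = is ! 1)) u))\<^sup>2 = 1"
      unfolding frobenius_singleton using that by (simp add: unit_vector_iff)
    then show ?thesis
      using frobenius_norm_nonneg by (simp add: power2_eq_1_iff) (metis neg_0_le_iff_le not_one_le_zero)
  qed
  then show ?thesis by simp
qed

text \<open>
  Each step from the identity matrix raises the order by one. Entries outside the format do not
  affect orthogonality and are set to zero at the end.
\<close>

lemma orthogonal_tensor_exists:
  fixes t :: "nat \<Rightarrow> nat \<Rightarrow> nat \<Rightarrow> real"
  assumes comp: "\<And>u v. (\<Sum>k<n. (\<Sum>i<n. \<Sum>j<n. u i * v j * t i j k)\<^sup>2) =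
      (\<Sum>i<n. (u i)\<^sup>2) * (\<Sum>j<n. (v j)\<^sup>2)"
    and "2 \<le> d"
  shows "\<exists>X\<in>tensors (replicate d n). orthogonal_tensor (replicate d n) X"
proof -
  have "\<exists>X. orthogonal_tensor (replicate d n) X"
    using \<open>2 \<le> d\<close>
  proof (induction d rule: dec_induct)
    case base
    then show ?case using orthogonal_identity_tensor[of n] by (auto simp: numeral_2_eq_2)
  next
    case (step d)
    then obtain X where X: "orthogonal_tensor (replicate d n) X" by blast
    from step obtain m where "d = Suc m" "replicate m n \<noteq> []"
      by (cases d) auto
    then show ?case
      using X orthogonal_compose_tensor[where t = t and n = n and ns = "replicate m n" and Y = X] comp
      by auto
  qed
  then obtain X where "orthogonal_tensor (replicate d n) X" by blast
  then have "orthogonal_tensor (replicate d n)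
      (\<lambda>is. if is \<in> multi_indices (replicate d n) then X is else 0)"
    by (subst orthogonal_tensor_cong[of _ _ X]) simp_all
  then show ?thesis
    by (intro bexI) (assumption, simp add: tensors_def)
qed

lemma normed_cayley_constants:
  assumes "n \<in> {1, 2, 4, 8}"
  shows "(\<Sum>k<n. (\<Sum>i<n. \<Sum>j<n. u i * v j * cayley_constant i j k)\<^sup>2) =
    (\<Sum>i<n. (u i)\<^sup>2) * (\<Sum>j<n. (v j)\<^sup>2)"
proof -
  have "n = 1 \<Longrightarrow> ?thesis"
    by (simp add: cayley_constant_def cayley_sign_def power_mult_distrib)
  then show ?thesis
    using assms two_square_identity four_square_identity eight_square_identity by auto
qed

section \<open>Orthogonal tensors of equal dimensions\<close>

theorem corollary4p6:
  fixes n d :: nat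
  assumes "n \<ge> 1" and "d \<ge> 3"
  shows "((\<exists>X\<in>tensors (replicate d n). orthogonal_tensor (replicate d n) X) \<longleftrightarrow> n \<in> {1, 2, 4, 8}) \<and>
         (App (replicate d n) = 1 / sqrt (real n ^ (d - 1)) \<longleftrightarrow> n \<in> {1, 2, 4, 8}) \<and>
         (n \<notin> {1, 2, 4, 8} \<longrightarrow> App (replicate d n) > 1 / sqrt (real n ^ (d - 1)))"
proof -
  let ?ns = "replicate d n"
  obtain m where d: "d = Suc m"
    using assms by (cases d) auto
  have "?ns = replicate m n @ [n]"
    by (simp only: d replicate_append_same replicate_Suc)
  then have "butlast ?ns = replicate m n"
    by (simp only: butlast_snoc)
  then have p: "real (prod_list (butlast ?ns)) = real n ^ (d - 1)"
    by (simp only: d prod_list_replicate of_nat_power diff_Suc_1)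
  have "?ns \<noteq> []" "\<forall>m\<in>set ?ns. 0 < m"
    using assms by auto
  from App_bound[OF this, unfolded p] have App: "1 / sqrt (real n ^ (d - 1)) \<le> App ?ns"
    "App ?ns = 1 / sqrt (real n ^ (d - 1)) \<longleftrightarrow> (\<exists>X\<in>tensors ?ns. orthogonal_tensor ?ns X)"
    .
  have "n \<in> {1, 2, 4, 8}" if "orthogonal_tensor ?ns X" for X
    using assms(2,1) that by (rule orthogonal_tensor_dimension)
  moreover have "\<exists>X\<in>tensors ?ns. orthogonal_tensor ?ns X" if "n \<in> {1, 2, 4, 8}"
    using orthogonal_tensor_exists[OF normed_cayley_constants[OF that], of d] assms(2) by linarith
  ultimately have "(\<exists>X\<in>tensors ?ns. orthogonal_tensor ?ns X) \<longleftrightarrow> n \<in> {1, 2, 4, 8}"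
    by blast
  with App show ?thesis
    by (metis order_le_imp_less_or_eq)
qed

end
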